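(* Let $h=h(t,x)$ be a solution to the linearised equation $$\partial_th=-\tfrac14\,\partial_x(xh)+2\mathcal{Q}_0(h,H),\qquad h(0,\cdot)=h_0,$$ with $\int_{\mathbb{R}}h_0\,dx=\int_{\mathbb{R}}x\,h_0\,dx=\int_{\mathbb{R}}x^2h_0\,dx=0$. Then, for $0\le k<3$, $$|||\widehat h(t,\cdot)|||_k\le\exp(-\sigma_kt)\,|||\widehat h_0|||_k\qquad\forall t\ge0,\qquad \sigma_k:=1-\tfrac14k-2^{1-k}.$$ In particular, for any $2<k<3$ one has $\sigma_k>0$, so that $h(t,\cdot)$ converges exponentially to $0$ in the $k$-Fourier norm $|||\cdot|||_k$ whenever $|||\widehat h_0|||_k<\infty$. Moreover, for any $1\le p<\infty$, $$|||\widehat h(t,\cdot)|||_{k,p}\le\exp(-\sigma_k(p)t)\,|||\widehat h_0|||_{k,p}\qquad\forall t\ge0,\qquad \sigma_k(p)=1-\tfrac14k+\tfrac1{4p}-2^{1+\frac1p-k}.$$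
   Context: $H(x)=\frac{2}{\pi(1+x^2)^2}$. Collision operator: $\mathcal{Q}_0(f,g)(x)=\int_{\mathbb{R}}f(x+\frac y2)g(x-\frac y2)\,dy-\frac12f(x)\int_{\mathbb{R}}g(y)\,dy-\frac12g(x)\int_{\mathbb{R}}f(y)\,dy$. Solutions are understood in the weak sense: $h:[0,\infty)\to\mathcal{M}_2(\mathbb{R})$, where $\mathcal{M}_2(\mathbb{R})$ is the set of real (signed) Borel measures $\mu$ on $\mathbb{R}$ with $\int(1+|x|)^2|\mu|(dx)<\infty$, and for all $\phi\in\mathcal{C}^1_b(\mathbb{R})$ $$\frac{d}{dt}\int\phi(x)h(t,dx)=\frac14\int x\phi'(x)h(t,dx)+2\iint\Big(\phi\big(\tfrac{x+y}2\big)-\tfrac12\phi(x)-\tfrac12\phi(y)\Big)h(t,dx)H(y)\,dy.$$ The linearised equation $\partial_th=-\tfrac14\,\partial_x(xh)+2\mathcal{Q}_0(h,H)$ preserves mass, momentum and energy under the normalisation $\int_{\mathbb{R}}h_0\,dx=\int_{\mathbb{R}}x\,h_0\,dx=\int_{\mathbb{R}}x^2h_0\,dx=0$ of $h_0$. Fourier transform: $\widehat f(\xi)=\int_{\mathbb{R}}f(x)e^{-ix\xi}dx$. Fourier norms (with values in $[0,\infty]$): $|||\psi|||_k=\sup_{\xi\ne0}\frac{|\psi(\xi)|}{|\xi|^k}$ and $|||\psi|||_{k,p}=\Big(\int_{\mathbb{R}}\frac{|\psi(\xi)|^p}{|\xi|^{kp}}\,d\xi\Big)^{1/p}$. *)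

theory Defs
  imports "HOL-Analysis.Analysis"
begin

subsection \<open>Finite signed measures\<close>

text \<open>
  A signed measure is represented by its set function; only the values on \<^term>\<open>sets M\<close> matter.
  Being real-valued, it is automatically finite.
\<close>

definition signed_measure :: "'a measure \<Rightarrow> ('a set \<Rightarrow> real) \<Rightarrow> bool" where
  "signed_measure M \<mu> \<longleftrightarrow>
     \<mu> {} = 0 \<and>
     (\<forall>A :: nat \<Rightarrow> 'a set. range A \<subseteq> sets M \<and> disjoint_family A \<longrightarrow>
        (\<lambda>i. \<mu> (A i)) sums \<mu> (\<Union>i. A i))"

text \<open>
  Jordan decomposition: the upper variation of \<open>\<mu>\<close> is \<open>A \<mapsto> sup {\<mu> B | B \<subseteq> A measurable}\<close>.
  Negative values of \<open>\<mu>\<close> are truncated to 0 by \<^const>\<open>ennreal\<close>, which does not change the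
  supremum since \<open>B = {}\<close> is admissible.
\<close>

definition upper_variation :: "'a measure \<Rightarrow> ('a set \<Rightarrow> real) \<Rightarrow> 'a set \<Rightarrow> ennreal" where
  "upper_variation M \<mu> A = (SUP B\<in>{B \<in> sets M. B \<subseteq> A}. ennreal (\<mu> B))"

definition pos_measure :: "'a measure \<Rightarrow> ('a set \<Rightarrow> real) \<Rightarrow> 'a measure" where
  "pos_measure M \<mu> = measure_of (space M) (sets M) (upper_variation M \<mu>)"

definition neg_measure :: "'a measure \<Rightarrow> ('a set \<Rightarrow> real) \<Rightarrow> 'a measure" where
  "neg_measure M \<mu> = pos_measure M (\<lambda>A. - \<mu> A)"

definition variation_measure :: "'a measure \<Rightarrow> ('a set \<Rightarrow> real) \<Rightarrow> 'a measure" where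
  "variation_measure M \<mu> = measure_of (space M) (sets M)
     (\<lambda>A. emeasure (pos_measure M \<mu>) A + emeasure (neg_measure M \<mu>) A)"

definition signed_integral ::
    "'a measure \<Rightarrow> ('a set \<Rightarrow> real) \<Rightarrow> ('a \<Rightarrow> 'b) \<Rightarrow> 'b::{banach, second_countable_topology}" where
  "signed_integral M \<mu> f =
     (LINT x|pos_measure M \<mu>. f x) - (LINT x|neg_measure M \<mu>. f x)"

lemma sets_pos_measure [simp, measurable_cong]: "sets (pos_measure M \<mu>) = sets M"
  and space_pos_measure [simp]: "space (pos_measure M \<mu>) = space M"
  by (simp_all add: pos_measure_def)

lemma sets_neg_measure [simp, measurable_cong]: "sets (neg_measure M \<mu>) = sets M"
  and space_neg_measure [simp]: "space (neg_measure M \<mu>) = space M"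
  by (simp_all add: neg_measure_def)

lemma sets_variation_measure [simp, measurable_cong]: "sets (variation_measure M \<mu>) = sets M"
  and space_variation_measure [simp]: "space (variation_measure M \<mu>) = space M"
  by (simp_all add: variation_measure_def)

lemma signed_measure_uminus:
  assumes "signed_measure M \<mu>"
  shows "signed_measure M (\<lambda>A. - \<mu> A)"
  using assms by (auto simp: signed_measure_def intro!: sums_minus)

lemma signed_measure_Un:
  assumes "signed_measure M \<mu>" "A \<in> sets M" "B \<in> sets M" "A \<inter> B = {}"
  shows "\<mu> (A \<union> B) = \<mu> A + \<mu> B"
proof -
  have "(\<lambda>i. \<mu> (binaryset A B i)) sums \<mu> (\<Union>i. binaryset A B i)"
  proof -
    have "range (binaryset A B) \<subseteq> sets M" "disjoint_family (binaryset A B)"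
      using assms(2-4) by (auto simp: range_binaryset_eq disjoint_family_on_def binaryset_def)
    then show ?thesis using assms(1) unfolding signed_measure_def by blast
  qed
  moreover have "(\<lambda>i. \<mu> (binaryset A B i)) sums (\<mu> A + \<mu> B)"
    using assms(1) by (intro binaryset_sums) (simp add: signed_measure_def)
  ultimately show ?thesis
    by (metis UN_binaryset_eq sums_unique2)
qed

text \<open>The upper variation is countably additive, so \<^const>\<open>pos_measure\<close> is not degenerate.\<close>

lemma countably_additive_upper_variation:
  assumes sm: "signed_measure M \<mu>"
  shows "countably_additive (sets M) (upper_variation M \<mu>)"
proof (rule countably_additiveI)
  fix A :: "nat \<Rightarrow> 'a set"
  assume A: "range A \<subseteq> sets M" "disjoint_family A" "(\<Union>i. A i) \<in> sets M"
  let ?u = "upper_variation M \<mu>"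
  have mono: "?u X \<le> ?u Y" if "X \<subseteq> Y" for X Y
    unfolding upper_variation_def using that by (intro SUP_subset_mono) auto
  have super: "?u X + ?u Y \<le> ?u (X \<union> Y)"
    if "X \<inter> Y = {}" for X Y
  proof -
    have *: "ennreal (\<mu> B) + ennreal (\<mu> C) \<le> ?u (X \<union> Y)"
      if "B \<in> sets M" "B \<subseteq> X" "C \<in> sets M" "C \<subseteq> Y" for B C
    proof -
      have d: "B \<inter> C = {}" using that \<open>X \<inter> Y = {}\<close> by auto
      have le: "ennreal (\<mu> D) \<le> ?u (X \<union> Y)" if "D \<in> sets M" "D \<subseteq> X \<union> Y" for D
        unfolding upper_variation_def using that by (intro SUP_upper) auto
      consider "\<mu> B \<le> 0" | "\<mu> C \<le> 0" | "\<mu> B \<ge> 0" "\<mu> C \<ge> 0" by linarith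
      then show ?thesis
      proof cases
        case 1
        then show ?thesis using le[of C] that by (auto simp: ennreal_neg)
      next
        case 2
        then show ?thesis using le[of B] that by (auto simp: ennreal_neg)
      next
        case 3
        then have "ennreal (\<mu> B) + ennreal (\<mu> C) = ennreal (\<mu> (B \<union> C))"
          using signed_measure_Un[OF sm _ _ d] that by (simp add: ennreal_plus)
        also have "\<dots> \<le> ?u (X \<union> Y)" using le[of "B \<union> C"] that by auto
        finally show ?thesis .
      qed
    qed
    have ne: "{B \<in> sets M. B \<subseteq> Z} \<noteq> {}" for Z by auto
    have "?u X + ennreal (\<mu> C) \<le> ?u (X \<union> Y)" if "C \<in> sets M" "C \<subseteq> Y" for C
      unfolding upper_variation_def[of M \<mu> X]
      using * that by (subst ennreal_SUP_add_left[symmetric, OF ne]) (auto intro!: SUP_least)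
    then show ?thesis
      unfolding upper_variation_def[of M \<mu> Y]
      by (subst ennreal_SUP_add_right[OF ne]) (auto intro!: SUP_least)
  qed
  show "(\<Sum>i. ?u (A i)) = ?u (\<Union>i. A i)"
  proof (rule antisym)
    have "(\<Sum>i<n. ?u (A i)) \<le> ?u (\<Union>i<n. A i)" for n
    proof (induction n)
      case 0
      show ?case by simp
    next
      case (Suc n)
      have "(\<Union>i<n. A i) \<inter> A n = {}"
      proof -
        have "A i \<inter> A n = {}" if "i < n" for i
          using disjoint_family_onD[OF A(2), of i n] that by simp
        then show ?thesis by auto
      qed
      from super[OF this] have "?u (\<Union>i<n. A i) + ?u (A n) \<le> ?u (\<Union>i<Suc n. A i)"
        by (simp add: lessThan_Suc Un_commute)
      moreover have "(\<Sum>i<Suc n. ?u (A i)) \<le> ?u (\<Union>i<n. A i) + ?u (A n)"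
        unfolding sum.lessThan_Suc by (intro add_right_mono Suc)
      ultimately show ?case by (rule order_trans[rotated])
    qed
    then have "(\<Sum>i<n. ?u (A i)) \<le> ?u (\<Union>i. A i)" for n
      by (rule order_trans) (intro mono, auto)
    then show "(\<Sum>i. ?u (A i)) \<le> ?u (\<Union>i. A i)"
      by (intro suminf_le_const) auto
  next
    have "ennreal (\<mu> B) \<le> (\<Sum>i. ?u (A i))" if B: "B \<in> sets M" "B \<subseteq> (\<Union>i. A i)" for B
    proof -
      have BA: "range (\<lambda>i. B \<inter> A i) \<subseteq> sets M" "disjoint_family (\<lambda>i. B \<inter> A i)"
        using A B(1) by (auto simp: disjoint_family_on_def)
      moreover have "(\<Union>i. B \<inter> A i) = B" using B(2) by auto
      ultimately have "(\<lambda>i. \<mu> (B \<inter> A i)) sums \<mu> B"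
        using sm unfolding signed_measure_def by metis
      then have "(\<lambda>n. ennreal (\<Sum>i<n. \<mu> (B \<inter> A i))) \<longlonglongrightarrow> ennreal (\<mu> B)"
        by (auto simp: sums_def intro: tendsto_ennrealI)
      moreover have "ennreal (\<Sum>i<n. \<mu> (B \<inter> A i)) \<le> (\<Sum>i. ?u (A i))" for n
      proof -
        have "ennreal (\<Sum>i<n. \<mu> (B \<inter> A i)) \<le> ennreal (\<Sum>i<n. max 0 (\<mu> (B \<inter> A i)))"
          by (intro ennreal_leI sum_mono) auto
        also have "\<dots> = (\<Sum>i<n. ennreal (\<mu> (B \<inter> A i)))"
          by (simp add: sum_ennreal[symmetric] max_def ennreal_neg del: sum_ennreal)
             (intro sum.cong refl, auto simp: ennreal_neg)
        also have "\<dots> \<le> (\<Sum>i<n. ?u (A i))"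
          unfolding upper_variation_def using BA(1) by (intro sum_mono SUP_upper) auto
        also have "\<dots> \<le> (\<Sum>i. ?u (A i))"
          by (intro sum_le_suminf) auto
        finally show ?thesis .
      qed
      ultimately show ?thesis by (auto intro: LIMSEQ_le_const2)
    qed
    then show "?u (\<Union>i. A i) \<le> (\<Sum>i. ?u (A i))"
      unfolding upper_variation_def[of M \<mu> "\<Union>i. A i"] by (intro SUP_least) auto
  qed
qed

lemma emeasure_pos_measure:
  assumes "signed_measure M \<mu>" "A \<in> sets M"
  shows "emeasure (pos_measure M \<mu>) A = upper_variation M \<mu> A"
  unfolding pos_measure_def
proof (rule emeasure_measure_of_sigma)
  show "positive (sets M) (upper_variation M \<mu>)"
    using assms(1) by (auto simp: positive_def upper_variation_def signed_measure_def
        intro!: antisym SUP_least)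
qed (use assms countably_additive_upper_variation sets.sigma_algebra_axioms in auto)

lemma emeasure_neg_measure:
  assumes "signed_measure M \<mu>" "A \<in> sets M"
  shows "emeasure (neg_measure M \<mu>) A = upper_variation M (\<lambda>B. - \<mu> B) A"
  unfolding neg_measure_def by (intro emeasure_pos_measure signed_measure_uminus assms)

lemma signed_measure_eq_pos_minus_neg:
  assumes sm: "signed_measure M \<mu>" and A: "A \<in> sets M"
    and fin: "emeasure (pos_measure M \<mu>) A < \<infinity>" "emeasure (neg_measure M \<mu>) A < \<infinity>"
  shows "\<mu> A = measure (pos_measure M \<mu>) A - measure (neg_measure M \<mu>) A"
proof -
  have *: "measure (pos_measure M \<nu>) A \<le> \<nu> A + measure (neg_measure M \<nu>) A"
    if sm': "signed_measure M \<nu>" and fin': "emeasure (pos_measure M \<nu>) A < \<infinity>"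
      "emeasure (neg_measure M \<nu>) A < \<infinity>" for \<nu>
  proof -
    let ?n = "measure (neg_measure M \<nu>) A"
    have n: "emeasure (neg_measure M \<nu>) A = ennreal ?n"
      using fin'(2) by (simp add: emeasure_eq_ennreal_measure)
    have bound: "\<nu> B \<le> \<nu> A + ?n" if B: "B \<in> sets M" "B \<subseteq> A" for B
    proof -
      have "\<nu> A = \<nu> B + \<nu> (A - B)"
        using signed_measure_Un[OF sm', of B "A - B"] A B by (simp add: Un_absorb1)
      moreover have "ennreal (- \<nu> (A - B)) \<le> ennreal ?n"
        unfolding n[symmetric] emeasure_neg_measure[OF sm' A] upper_variation_def
        using A B by (intro SUP_upper) auto
      then have "- \<nu> (A - B) \<le> ?n"
        using measure_nonneg[of "neg_measure M \<nu>" A] by (simp add: ennreal_le_iff)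
      ultimately show ?thesis by linarith
    qed
    have "\<nu> {} = 0" using sm' by (simp add: signed_measure_def)
    with bound[of "{}"] have nonneg: "0 \<le> \<nu> A + ?n" by simp
    have "emeasure (pos_measure M \<nu>) A \<le> ennreal (\<nu> A + ?n)"
      unfolding emeasure_pos_measure[OF sm' A] upper_variation_def
      using bound by (intro SUP_least ennreal_leI) auto
    then show ?thesis
      using nonneg fin'(1) by (simp add: emeasure_eq_ennreal_measure)
  qed
  show ?thesis
    using *[OF sm fin] *[OF signed_measure_uminus[OF sm]] fin by (simp add: neg_measure_def)
qed

lemma emeasure_variation_measure:
  assumes "A \<in> sets M"
  shows "emeasure (variation_measure M \<mu>) A =
    emeasure (pos_measure M \<mu>) A + emeasure (neg_measure M \<mu>) A"
  unfolding variation_measure_def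
proof (rule emeasure_measure_of_sigma)
  show "countably_additive (sets M)
     (\<lambda>A. emeasure (pos_measure M \<mu>) A + emeasure (neg_measure M \<mu>) A)"
    by (rule countably_additiveI)
       (simp add: suminf_add[symmetric] suminf_emeasure image_subset_iff)
qed (use assms sets.sigma_algebra_axioms in \<open>auto simp: positive_def\<close>)

subsection \<open>Fourier transform and Fourier norms\<close>

definition fourier_transform :: "(real set \<Rightarrow> real) \<Rightarrow> real \<Rightarrow> complex" where
  "fourier_transform \<mu> \<xi> =
     signed_integral borel \<mu> (\<lambda>x. exp (- (\<i> * complex_of_real x * complex_of_real \<xi>)))"

definition fourier_norm :: "real \<Rightarrow> (real \<Rightarrow> complex) \<Rightarrow> ennreal" where
  "fourier_norm k \<psi> = (SUP \<xi>\<in>-{0}. ennreal (cmod (\<psi> \<xi>) / \<bar>\<xi>\<bar> powr k))"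

definition ennreal_powr :: "ennreal \<Rightarrow> real \<Rightarrow> ennreal" where
  "ennreal_powr x a = (if x = \<infinity> then \<infinity> else ennreal (enn2real x powr a))"

text \<open>
  At the single point \<open>\<xi> = 0\<close> the integrand is 0 by the convention \<open>z / 0 = 0\<close>; this point is a
  Lebesgue null set.
\<close>

definition fourier_norm_Lp :: "real \<Rightarrow> real \<Rightarrow> (real \<Rightarrow> complex) \<Rightarrow> ennreal" where
  "fourier_norm_Lp k p \<psi> =
     ennreal_powr (\<integral>\<^sup>+\<xi>. ennreal (cmod (\<psi> \<xi>) powr p / \<bar>\<xi>\<bar> powr (k * p)) \<partial>lborel) (1 / p)"

subsection \<open>The linearised equation\<close>

definition H :: "real \<Rightarrow> real" where
  "H x = 2 / (pi * (1 + x\<^sup>2)\<^sup>2)"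

definition M2 :: "(real set \<Rightarrow> real) set" where
  "M2 = {\<mu>. signed_measure borel \<mu> \<and>
            (\<integral>\<^sup>+x. ennreal ((1 + \<bar>x\<bar>)\<^sup>2) \<partial>variation_measure borel \<mu>) < \<infinity>}"

definition C1b :: "(real \<Rightarrow> real) set" where
  "C1b = {\<phi>. (\<forall>x. \<phi> differentiable (at x)) \<and> continuous_on UNIV (deriv \<phi>) \<and>
             bounded (range \<phi>) \<and> bounded (range (deriv \<phi>))}"

text \<open>
  The right-hand side of the weak form of \<open>\<partial>\<^sub>t h = - 1/4 \<partial>\<^sub>x (x h) + 2 Q\<^sub>0(h, H)\<close>, where
  \<open>Q\<^sub>0(f, g)(x) = \<integral> f (x + y/2) g (x - y/2) dy - 1/2 f(x) \<integral> g - 1/2 g(x) \<integral> f\<close>. Testing the gain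
  term against \<open>\<phi>\<close> and substituting \<open>(u, v) = (x + y/2, x - y/2)\<close>, which has Jacobian of modulus 1
  and \<open>x = (u + v)/2\<close>, turns it into \<open>\<integral>\<integral> \<phi> ((u + v)/2) f(u) g(v) du dv\<close>.
\<close>

definition weak_rhs :: "(real set \<Rightarrow> real) \<Rightarrow> (real \<Rightarrow> real) \<Rightarrow> real" where
  "weak_rhs \<mu> \<phi> =
     1 / 4 * signed_integral borel \<mu> (\<lambda>x. x * deriv \<phi> x) +
     2 * (LINT y|lborel.
            signed_integral borel \<mu> (\<lambda>x. \<phi> ((x + y) / 2) - 1 / 2 * \<phi> x - 1 / 2 * \<phi> y) * H y)"

text \<open>
  The time derivative is one-sided at \<open>t = 0\<close>. The initial condition is equality of measures, hence
  stated on Borel sets.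
\<close>

definition weak_solution :: "(real \<Rightarrow> real set \<Rightarrow> real) \<Rightarrow> (real set \<Rightarrow> real) \<Rightarrow> bool" where
  "weak_solution h h0 \<longleftrightarrow>
     (\<forall>t\<ge>0. h t \<in> M2) \<and>
     (\<forall>A\<in>sets borel. h 0 A = h0 A) \<and>
     (\<forall>\<phi>\<in>C1b. \<forall>t\<ge>0.
        ((\<lambda>s. signed_integral borel (h s) \<phi>) has_real_derivative weak_rhs (h t) \<phi>)
          (at t within {0..}))"

definition decay_rate :: "real \<Rightarrow> real" where
  "decay_rate k = 1 - 1 / 4 * k - 2 powr (1 - k)"

definition decay_rate_Lp :: "real \<Rightarrow> real \<Rightarrow> real" where
  "decay_rate_Lp k p = 1 - 1 / 4 * k + 1 / (4 * p) - 2 powr (1 + 1 / p - k)"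

end

theory Submission
  imports Defs "HOL-Real_Asymp.Real_Asymp"
begin

text \<open>
  Write \<open>F t \<xi>\<close> for the Fourier transform of \<open>h t\<close>. Mass conservation gives \<open>F t 0 = 0\<close>, and testing
  with characters turns the equation into
  \<open>\<partial>\<^sub>t F = \<xi>/4 \<partial>\<^sub>\<xi> F - F + 2 F(t, \<xi>/2) Hhat(\<xi>/2)\<close> with \<open>|Hhat| \<le> 1\<close>. Along characteristics,
  \<open>g t \<xi> = exp t * F t (\<xi> exp (- t/4))\<close> satisfies \<open>|g t \<xi>| \<le> |g 0 \<xi>| + 2 \<integral>\<^sub>0\<^sup>t |g s (\<xi>/2)| ds\<close>, and
  iterating gives \<open>|g t \<xi>| \<le> \<Sum>\<^sub>n (2t)\<^sup>n/n! |g 0 (\<xi>/2\<^sup>n)|\<close>. Both estimates follow by summing the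
  exponential series, for \<open>L\<^sup>p\<close> by means of Jensen's inequality with the weights \<open>(2tr)\<^sup>n/n!\<close>,
  \<open>r = 2\<^sup>1\<^sup>/\<^sup>p\<^sup>-\<^sup>k\<close>.

  A weak solution is only pointwise differentiable in time and carries no moment bound that is
  uniform in time, so Duhamel's formula along characteristics is not immediate. A gliding hump
  argument shows that \<open>F\<close> is locally bounded; this suffices to justify the formula for averages of
  \<open>F\<close> in \<open>\<xi>\<close> against a \<open>C\<^sup>1\<close> weight transported by the characteristics, and concentrating the
  weight yields the pointwise formula.
\<close>

subsection \<open>Integrals depending on a parameter\<close>

lemma has_vector_derivative_lebesgue_integral:
  fixes f f' :: "real \<Rightarrow> 'a \<Rightarrow> 'b::{banach, second_countable_topology}"
  assumes f: "\<And>x. integrable M (f x)"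
    and f': "f' x \<in> borel_measurable M"
    and deriv: "\<And>x \<omega>. \<omega> \<in> space M \<Longrightarrow> ((\<lambda>x. f x \<omega>) has_vector_derivative f' x \<omega>) (at x)"
    and bound: "\<And>x \<omega>. \<omega> \<in> space M \<Longrightarrow> norm (f' x \<omega>) \<le> g \<omega>"
    and g: "integrable M g"
  shows "((\<lambda>x. \<integral>\<omega>. f x \<omega> \<partial>M) has_vector_derivative (\<integral>\<omega>. f' x \<omega> \<partial>M)) (at x)"
  unfolding has_vector_derivative_def has_derivative_at_within
proof (intro conjI)
  have lip: "norm (f y \<omega> - f x \<omega>) \<le> g \<omega> * \<bar>y - x\<bar>" if "\<omega> \<in> space M" for y \<omega>
  proof -
    have "onorm (\<lambda>h. h *\<^sub>R f' x \<omega>) \<le> g \<omega>" for x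
      using bound[OF that, of x] by (intro onorm_le) (simp add: mult.commute mult_left_mono)
    then have "norm (f y \<omega> - f x \<omega>) \<le> g \<omega> * norm (y - x)"
      using deriv[OF that]
      by (intro differentiable_bound[of UNIV "\<lambda>x. f x \<omega>" "\<lambda>x h. h *\<^sub>R f' x \<omega>"])
        (auto simp: has_vector_derivative_def)
    then show ?thesis by simp
  qed
  show "((\<lambda>y. ((\<integral>\<omega>. f y \<omega> \<partial>M) - (\<integral>\<omega>. f x \<omega> \<partial>M) - (y - x) *\<^sub>R (\<integral>\<omega>. f' x \<omega> \<partial>M)) /\<^sub>R norm (y - x))
          \<longlongrightarrow> 0) (at x)"
    unfolding tendsto_at_iff_sequentially
  proof (intro allI impI)
    fix X :: "nat \<Rightarrow> real" assume X: "\<forall>i. X i \<in> UNIV - {x}" "X \<longlonglongrightarrow> x"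
    have int_f': "integrable M (f' x)"
      using bound by (intro Bochner_Integration.integrable_bound[OF g f'] AE_I2)
        (metis abs_ge_self order_trans real_norm_def)
    have "(\<lambda>i. \<integral>\<omega>. (f (X i) \<omega> - f x \<omega> - (X i - x) *\<^sub>R f' x \<omega>) /\<^sub>R norm (X i - x) \<partial>M)
           \<longlonglongrightarrow> (\<integral>\<omega>. 0 \<partial>M)"
    proof (rule integral_dominated_convergence[where w = "\<lambda>\<omega>. 2 * g \<omega>"])
      show "(\<lambda>\<omega>. (f (X i) \<omega> - f x \<omega> - (X i - x) *\<^sub>R f' x \<omega>) /\<^sub>R norm (X i - x)) \<in> borel_measurable M" for i
        using f f' by (intro borel_measurable_scaleR borel_measurable_diff) auto
      show "AE \<omega> in M. (\<lambda>i. (f (X i) \<omega> - f x \<omega> - (X i - x) *\<^sub>R f' x \<omega>) /\<^sub>R norm (X i - x)) \<longlonglongrightarrow> 0"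
      proof (intro AE_I2)
        fix \<omega> assume "\<omega> \<in> space M"
        from deriv[OF this] have "((\<lambda>y. (f y \<omega> - f x \<omega> - (y - x) *\<^sub>R f' x \<omega>) /\<^sub>R norm (y - x)) \<longlongrightarrow> 0) (at x)"
          by (simp add: has_vector_derivative_def has_derivative_at_within)
        then show "(\<lambda>i. (f (X i) \<omega> - f x \<omega> - (X i - x) *\<^sub>R f' x \<omega>) /\<^sub>R norm (X i - x)) \<longlonglongrightarrow> 0"
          using X unfolding tendsto_at_iff_sequentially by (auto simp: o_def)
      qed
      show "AE \<omega> in M. norm ((f (X i) \<omega> - f x \<omega> - (X i - x) *\<^sub>R f' x \<omega>) /\<^sub>R norm (X i - x)) \<le> 2 * g \<omega>" for i
      proof (intro AE_I2)
        fix \<omega> assume \<omega>: "\<omega> \<in> space M"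
        have "norm (f (X i) \<omega> - f x \<omega> - (X i - x) *\<^sub>R f' x \<omega>)
            \<le> g \<omega> * \<bar>X i - x\<bar> + \<bar>X i - x\<bar> * g \<omega>"
          by (rule order_trans[OF norm_triangle_ineq4 add_mono])
            (use lip[OF \<omega>] bound[OF \<omega>] in \<open>auto intro: mult_left_mono\<close>)
        then show "norm ((f (X i) \<omega> - f x \<omega> - (X i - x) *\<^sub>R f' x \<omega>) /\<^sub>R norm (X i - x)) \<le> 2 * g \<omega>"
          using X(1)[rule_format, of i] unfolding norm_scaleR
          by (simp add: divide_inverse[symmetric] pos_divide_le_eq mult.commute[of "inverse _"] mult.assoc)
      qed
    qed (use g in auto)
    then show "((\<lambda>y. ((\<integral>\<omega>. f y \<omega> \<partial>M) - (\<integral>\<omega>. f x \<omega> \<partial>M) - (y - x) *\<^sub>R (\<integral>\<omega>. f' x \<omega> \<partial>M)) /\<^sub>R norm (y - x)) \<circ> X)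
        \<longlonglongrightarrow> 0"
      using f int_f' by (simp add: o_def)
  qed
qed (auto intro!: bounded_linear_intros)

lemma continuous_lebesgue_integral:
  fixes f :: "'c::first_countable_topology \<Rightarrow> 'a \<Rightarrow> 'b::{banach, second_countable_topology}"
  assumes f: "\<And>x. f x \<in> borel_measurable M"
    and cont: "\<And>\<omega>. \<omega> \<in> space M \<Longrightarrow> continuous_on UNIV (\<lambda>x. f x \<omega>)"
    and bound: "\<And>x \<omega>. \<omega> \<in> space M \<Longrightarrow> norm (f x \<omega>) \<le> g \<omega>"
    and g: "integrable M g"
  shows "continuous_on UNIV (\<lambda>x. \<integral>\<omega>. f x \<omega> \<partial>M)"
  unfolding continuous_on_def tendsto_at_iff_sequentially
proof (intro allI impI ballI)
  fix x :: 'c and X :: "nat \<Rightarrow> 'c" assume X: "\<forall>i. X i \<in> UNIV - {x}" "X \<longlonglongrightarrow> x"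
  show "((\<lambda>x. \<integral>\<omega>. f x \<omega> \<partial>M) \<circ> X) \<longlonglongrightarrow> (\<integral>\<omega>. f x \<omega> \<partial>M)"
    unfolding o_def
  proof (rule integral_dominated_convergence[where w = g])
    show "AE \<omega> in M. (\<lambda>i. f (X i) \<omega>) \<longlonglongrightarrow> f x \<omega>"
    proof (intro AE_I2)
      fix \<omega> assume "\<omega> \<in> space M"
      then show "(\<lambda>i. f (X i) \<omega>) \<longlonglongrightarrow> f x \<omega>"
        using continuous_on_tendsto_compose[OF cont X(2), of \<omega>] by simp
    qed
  qed (use f g bound in auto)
qed

subsection \<open>Characters and the kernel \<^const>\<open>H\<close>\<close>

definition fchar :: "real \<Rightarrow> real \<Rightarrow> complex" where
  "fchar \<xi> x = exp (- (\<i> * complex_of_real x * complex_of_real \<xi>))"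

lemma norm_fchar [simp]: "cmod (fchar \<xi> x) = 1"
  by (simp add: fchar_def norm_exp_eq_Re)

lemma fchar_commute: "fchar \<xi> x = fchar x \<xi>"
  by (simp add: fchar_def mult_ac)

lemma fchar_midpoint: "fchar \<xi> ((x + y) / 2) = fchar (\<xi> / 2) y * fchar (\<xi> / 2) x"
  unfolding fchar_def exp_add[symmetric]
  by (rule arg_cong[where f = exp]) (simp add: field_simps)

lemma continuous_on_fchar [continuous_intros]:
  "continuous_on A f \<Longrightarrow> continuous_on A g \<Longrightarrow> continuous_on A (\<lambda>x. fchar (f x) (g x))"
  unfolding fchar_def by (intro continuous_intros)

lemma borel_measurable_fchar [measurable (raw)]:
  assumes "f \<in> borel_measurable M" "g \<in> borel_measurable M"
  shows "(\<lambda>x. fchar (f x) (g x)) \<in> borel_measurable M"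
proof -
  have "(\<lambda>p. fchar (fst p) (snd p)) \<in> borel_measurable (borel \<Otimes>\<^sub>M borel)"
    unfolding borel_prod by (intro borel_measurable_continuous_onI continuous_intros)
  from measurable_compose[OF measurable_Pair[OF assms] this] show ?thesis by simp
qed

lemma has_vector_derivative_fchar:
  "(fchar \<xi> has_vector_derivative - \<i> * complex_of_real \<xi> * fchar \<xi> x) (at x within S)"
proof -
  have "((\<lambda>z. exp (- (\<i> * z * complex_of_real \<xi>))) has_field_derivative
      - \<i> * complex_of_real \<xi> * fchar \<xi> x) (at (complex_of_real x))"
    unfolding fchar_def by (auto intro!: derivative_eq_intros)
  from has_vector_derivative_real_field[OF this] show ?thesis
    unfolding fchar_def o_def .
qed

lemma has_vector_derivative_fchar':
  "((\<lambda>\<xi>. fchar \<xi> x) has_vector_derivative - \<i> * complex_of_real x * fchar \<xi> x) (at \<xi> within S)"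
  using has_vector_derivative_fchar[of x \<xi> S] by (simp add: fchar_commute[of _ x])

lemma H_nonneg: "0 \<le> H x"
  by (simp add: H_def)

lemma H_measurable [measurable]: "H \<in> borel_measurable borel"
  unfolding H_def by measurable

lemma H_integral: "has_bochner_integral lborel H 1"
proof -
  let ?F = "\<lambda>x::real. (x / (1 + x\<^sup>2) + arctan x) / pi"
  have nz: "1 + x\<^sup>2 \<noteq> 0" for x :: real by (smt (verit) zero_le_power2)
  have F: "(?F has_real_derivative H x) (at x)" for x
  proof -
    have "(?F has_real_derivative ((1 * (1 + x\<^sup>2) - x * (2 * x)) / ((1 + x\<^sup>2) * (1 + x\<^sup>2))
        + 1 / (1 + x\<^sup>2)) / pi) (at x)"
      using nz[of x] by (auto intro!: derivative_eq_intros simp: inverse_eq_divide)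
    also have "((1 * (1 + x\<^sup>2) - x * (2 * x)) / ((1 + x\<^sup>2) * (1 + x\<^sup>2)) + 1 / (1 + x\<^sup>2)) / pi = H x"
      unfolding H_def using nz[of x] by (simp add: divide_simps) (simp add: power2_eq_square algebra_simps)
    finally show ?thesis .
  qed
  have cont: "isCont H x" for x
    unfolding H_def using nz[of x] by (intro continuous_intros) auto
  have "(?F \<longlongrightarrow> (0 + - (pi / 2)) / pi) at_bot"
    by (intro tendsto_intros tendsto_arctan_at_bot) (real_asymp, simp)
  then have A: "((?F \<circ> real_of_ereal) \<longlongrightarrow> - 1 / 2) (at_right (-\<infinity>))"
    unfolding ereal_tendsto_simps1 by simp
  have "(?F \<longlongrightarrow> (0 + pi / 2) / pi) at_top"
    by (intro tendsto_intros tendsto_arctan_at_top) (real_asymp, simp)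
  then have B: "((?F \<circ> real_of_ereal) \<longlongrightarrow> 1 / 2) (at_left \<infinity>)"
    unfolding ereal_tendsto_simps1 by simp
  have "set_integrable lborel (einterval (-\<infinity>) \<infinity>) H" "(LBINT x=-\<infinity>..\<infinity>. H x) = 1 / 2 - - 1 / 2"
    by (rule interval_integral_FTC_nonneg[OF _ F cont _ A B]; simp add: H_nonneg)+
  then show ?thesis
    by (simp add: has_bochner_integral_iff set_integrable_def interval_integral_to_infinity_eq
      interval_lebesgue_integral_def set_lebesgue_integral_def)
qed

subsection \<open>Superpositions of characters as test functions\<close>

lemma M2_finite_moment:
  assumes "\<mu> \<in> M2"
  shows "(\<integral>\<^sup>+x. ennreal ((1 + \<bar>x\<bar>)\<^sup>2) \<partial>pos_measure borel \<mu>) < \<infinity>" (is ?pos)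
    and "(\<integral>\<^sup>+x. ennreal ((1 + \<bar>x\<bar>)\<^sup>2) \<partial>neg_measure borel \<mu>) < \<infinity>" (is ?neg)
proof -
  have fin: "(\<integral>\<^sup>+x. ennreal ((1 + \<bar>x\<bar>)\<^sup>2) \<partial>variation_measure borel \<mu>) < \<infinity>"
    using assms by (simp add: M2_def)
  have "pos_measure borel \<mu> \<le> variation_measure borel \<mu>"
    by (auto simp: le_measure emeasure_variation_measure le_fun_def)
  then show ?pos
    by (intro le_less_trans[OF nn_integral_mono_measure fin]) simp_all
  have "neg_measure borel \<mu> \<le> variation_measure borel \<mu>"
    by (auto simp: le_measure emeasure_variation_measure le_fun_def)
  then show ?neg
    by (intro le_less_trans[OF nn_integral_mono_measure fin]) simp_all
qed

lemma integrable_linear_growth: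
  fixes f :: "real \<Rightarrow> 'b::{banach, second_countable_topology}"
  assumes P: "(\<integral>\<^sup>+x. ennreal ((1 + \<bar>x\<bar>)\<^sup>2) \<partial>P) < \<infinity>" "sets P = sets borel"
    and f: "f \<in> borel_measurable borel" "\<And>x. norm (f x) \<le> C * (1 + \<bar>x\<bar>)"
  shows "integrable P f"
proof (rule Bochner_Integration.integrable_bound)
  show "integrable P (\<lambda>x. C * (1 + \<bar>x\<bar>)\<^sup>2)"
    using P by (intro integrable_mult_right integrableI_bounded)
      (auto simp: measurable_cong_sets[OF P(2) refl])
  show "f \<in> borel_measurable P"
    using f(1) by (simp add: measurable_cong_sets[OF P(2) refl])
  have "norm (f x) \<le> norm (C * (1 + \<bar>x\<bar>)\<^sup>2)" for x
  proof -
    have "0 \<le> C" using order_trans[OF norm_ge_zero f(2)[of 0]] by simp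
    then have "C * (1 + \<bar>x\<bar>) \<le> C * (1 + \<bar>x\<bar>)\<^sup>2"
      by (intro mult_left_mono) (auto simp: power2_eq_square algebra_simps)
    with f(2)[of x] \<open>0 \<le> C\<close> show ?thesis by simp
  qed
  then show "AE x in P. norm (f x) \<le> norm (C * (1 + \<bar>x\<bar>)\<^sup>2)" by simp
qed

lemma integrable_M2:
  fixes f :: "real \<Rightarrow> 'b::{banach, second_countable_topology}"
  assumes "\<mu> \<in> M2" "f \<in> borel_measurable borel" "\<And>x. norm (f x) \<le> C * (1 + \<bar>x\<bar>)"
  shows "integrable (pos_measure borel \<mu>) f" "integrable (neg_measure borel \<mu>) f"
  using assms M2_finite_moment by (auto intro!: integrable_linear_growth)

lemma integrable_M2_bounded:
  fixes f :: "real \<Rightarrow> 'b::{banach, second_countable_topology}"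
  assumes "\<mu> \<in> M2" "f \<in> borel_measurable borel" "\<And>x. norm (f x) \<le> C"
  shows "integrable (pos_measure borel \<mu>) f" "integrable (neg_measure borel \<mu>) f"
proof -
  have "norm (f x) \<le> C * (1 + \<bar>x\<bar>)" for x
    using assms(3)[of x] norm_ge_zero[of "f x"] mult_left_mono[of 1 "1 + \<bar>x\<bar>" C] by linarith
  then show "integrable (pos_measure borel \<mu>) f" "integrable (neg_measure borel \<mu>) f"
    using integrable_M2[OF assms(1,2)] by auto
qed

lemma finite_measure_M2:
  assumes "\<mu> \<in> M2"
  shows "finite_measure (pos_measure borel \<mu>)" "finite_measure (neg_measure borel \<mu>)"
proof -
  have "integrable (pos_measure borel \<mu>) (\<lambda>_. 1::real)" "integrable (neg_measure borel \<mu>) (\<lambda>_. 1::real)"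
    by (rule integrable_M2_bounded[OF assms, where C = 1]; simp)+
  then show "finite_measure (pos_measure borel \<mu>)" "finite_measure (neg_measure borel \<mu>)"
    unfolding integrable_iff_bounded by (intro finite_measureI; simp)+
qed

definition superposition :: "'w measure \<Rightarrow> ('w \<Rightarrow> complex) \<Rightarrow> ('w \<Rightarrow> real) \<Rightarrow> real \<Rightarrow> complex" where
  "superposition N a z x = (\<integral>\<omega>. a \<omega> * fchar (z \<omega>) x \<partial>N)"

lemma integrable_mult_bounded:
  fixes a b :: "'w \<Rightarrow> complex"
  assumes "integrable N a" "b \<in> borel_measurable N" "\<And>\<omega>. cmod (b \<omega>) \<le> B"
  shows "integrable N (\<lambda>\<omega>. a \<omega> * b \<omega>)"
proof (rule Bochner_Integration.integrable_bound)
  show "integrable N (\<lambda>\<omega>. B * cmod (a \<omega>))" using assms(1) by auto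
  have "cmod (a \<omega> * b \<omega>) \<le> norm (B * cmod (a \<omega>))" for \<omega>
    using mult_left_mono[OF assms(3), of "cmod (a \<omega>)" \<omega>] order_trans[OF norm_ge_zero assms(3)[of \<omega>]]
    by (simp add: norm_mult mult.commute)
  then show "AE \<omega> in N. cmod (a \<omega> * b \<omega>) \<le> norm (B * cmod (a \<omega>))" by simp
qed (use assms in measurable)

lemma superposition_fubini:
  assumes N: "sigma_finite_measure N" and P: "sigma_finite_measure P" "sets P = sets borel"
    and a: "integrable N a" and c: "integrable P c" and z[measurable]: "z \<in> borel_measurable N"
  shows "(\<integral>x. c x * superposition N a z x \<partial>P) = (\<integral>\<omega>. a \<omega> * (\<integral>x. c x * fchar (z \<omega>) x \<partial>P) \<partial>N)"
    and "integrable P (\<lambda>x. c x * superposition N a z x)"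
    and "integrable N (\<lambda>\<omega>. a \<omega> * (\<integral>x. c x * fchar (z \<omega>) x \<partial>P))"
proof -
  interpret pair_sigma_finite P N
    using N P by (simp add: pair_sigma_finite_def)
  have [measurable]: "a \<in> borel_measurable N" "c \<in> borel_measurable P"
    using a c by auto
  have [measurable]: "(\<lambda>x. x) \<in> borel_measurable P"
    using P(2) by (simp add: measurable_cong_sets[OF P(2) refl])
  have int: "integrable (P \<Otimes>\<^sub>M N) (\<lambda>(x, \<omega>). c x * (a \<omega> * fchar (z \<omega>) x))"
  proof (rule Fubini_integrable)
    show "(\<lambda>(x, \<omega>). c x * (a \<omega> * fchar (z \<omega>) x)) \<in> borel_measurable (P \<Otimes>\<^sub>M N)"
      by measurable
    show "integrable P (\<lambda>x. \<integral>\<omega>. norm (case (x, \<omega>) of (x, \<omega>) \<Rightarrow> c x * (a \<omega> * fchar (z \<omega>) x)) \<partial>N)"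
      using a c by (simp add: norm_mult)
    have "integrable N (\<lambda>\<omega>. c x * (a \<omega> * fchar (z \<omega>) x))" for x
      by (intro integrable_mult_right integrable_mult_bounded[OF a, where B = 1]) auto
    then show "AE x in P. integrable N (\<lambda>\<omega>. case (x, \<omega>) of (x, \<omega>) \<Rightarrow> c x * (a \<omega> * fchar (z \<omega>) x))"
      by simp
  qed
  have 1: "(\<integral>\<omega>. c x * (a \<omega> * fchar (z \<omega>) x) \<partial>N) = c x * superposition N a z x" for x
    by (simp add: superposition_def)
  have 2: "(\<integral>x. c x * (a \<omega> * fchar (z \<omega>) x) \<partial>P) = a \<omega> * (\<integral>x. c x * fchar (z \<omega>) x \<partial>P)" for \<omega>
    by (simp add: mult.left_commute)
  show "(\<integral>x. c x * superposition N a z x \<partial>P) = (\<integral>\<omega>. a \<omega> * (\<integral>x. c x * fchar (z \<omega>) x \<partial>P) \<partial>N)"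
    using Fubini_integral[OF int] by (simp only: 1 2)
  show "integrable P (\<lambda>x. c x * superposition N a z x)"
    using integrable_fst[OF int] by (simp only: 1)
  show "integrable N (\<lambda>\<omega>. a \<omega> * (\<integral>x. c x * fchar (z \<omega>) x \<partial>P))"
    using integrable_snd[OF int] by (simp only: 2)
qed

definition fourier_deriv :: "(real set \<Rightarrow> real) \<Rightarrow> real \<Rightarrow> complex" where
  "fourier_deriv \<mu> \<xi> = signed_integral borel \<mu> (\<lambda>x. - \<i> * complex_of_real x * fchar \<xi> x)"

lemma fourier_transform_eq: "fourier_transform \<mu> \<xi> = signed_integral borel \<mu> (fchar \<xi>)"
  by (simp add: fourier_transform_def fchar_def[abs_def])

lemma has_vector_derivative_fourier_transform:
  assumes "\<mu> \<in> M2"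
  shows "(fourier_transform \<mu> has_vector_derivative fourier_deriv \<mu> \<xi>) (at \<xi>)"
proof -
  have *: "((\<lambda>\<xi>. \<integral>x. fchar \<xi> x \<partial>P) has_vector_derivative (\<integral>x. - \<i> * complex_of_real x * fchar \<xi> x \<partial>P)) (at \<xi>)"
    if P: "(\<integral>\<^sup>+x. ennreal ((1 + \<bar>x\<bar>)\<^sup>2) \<partial>P) < \<infinity>" "sets P = sets borel" for P
  proof (rule has_vector_derivative_lebesgue_integral[where f = fchar
        and f' = "\<lambda>\<xi> x. - \<i> * complex_of_real x * fchar \<xi> x" and g = "\<lambda>x. 1 + \<bar>x\<bar>"])
    show "integrable P (fchar \<xi>)" for \<xi>
      by (rule integrable_linear_growth[OF P, where C = 1]) auto
    show "integrable P (\<lambda>x. 1 + \<bar>x\<bar>)"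
      by (rule integrable_linear_growth[OF P, where C = 1]) auto
    have "(\<lambda>x. - \<i> * complex_of_real x * fchar \<xi> x) \<in> borel_measurable borel" by measurable
    then show "(\<lambda>x. - \<i> * complex_of_real x * fchar \<xi> x) \<in> borel_measurable P"
      by (simp add: measurable_cong_sets[OF P(2) refl])
  qed (rule has_vector_derivative_fchar', simp add: norm_mult)
  show ?thesis
    unfolding fourier_transform_eq[abs_def] fourier_deriv_def signed_integral_def
    using M2_finite_moment[OF assms] by (intro has_vector_derivative_diff *) auto
qed

lemma continuous_on_fourier_transform:
  "\<mu> \<in> M2 \<Longrightarrow> continuous_on A (fourier_transform \<mu>)"
  by (meson has_vector_derivative_continuous has_vector_derivative_fourier_transform
      continuous_at_imp_continuous_on)

lemma continuous_on_fourier_deriv: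
  assumes "\<mu> \<in> M2"
  shows "continuous_on UNIV (fourier_deriv \<mu>)"
proof -
  have *: "continuous_on UNIV (\<lambda>\<xi>. \<integral>x. - \<i> * complex_of_real x * fchar \<xi> x \<partial>P)"
    if P: "(\<integral>\<^sup>+x. ennreal ((1 + \<bar>x\<bar>)\<^sup>2) \<partial>P) < \<infinity>" "sets P = sets borel" for P
  proof (rule continuous_lebesgue_integral[where g = "\<lambda>x. 1 + \<bar>x\<bar>"])
    have "(\<lambda>x. - \<i> * complex_of_real x * fchar \<xi> x) \<in> borel_measurable borel" for \<xi> by measurable
    then show "(\<lambda>x. - \<i> * complex_of_real x * fchar \<xi> x) \<in> borel_measurable P" for \<xi>
      by (simp add: measurable_cong_sets[OF P(2) refl])
    show "integrable P (\<lambda>x. 1 + \<bar>x\<bar>)"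
      by (rule integrable_linear_growth[OF P, where C = 1]) auto
  qed (auto intro!: continuous_intros simp: norm_mult)
  show ?thesis
    unfolding fourier_deriv_def[abs_def] signed_integral_def
    using M2_finite_moment[OF assms] by (intro continuous_on_diff *) auto
qed

lemma bounded_fourier_transform:
  assumes "\<mu> \<in> M2"
  shows "\<exists>V. \<forall>\<xi>. cmod (fourier_transform \<mu> \<xi>) \<le> V"
proof -
  have "cmod (fourier_transform \<mu> \<xi>) \<le>
      (\<integral>x. 1 \<partial>pos_measure borel \<mu>) + (\<integral>x. 1 \<partial>neg_measure borel \<mu>)" for \<xi>
    unfolding fourier_transform_eq signed_integral_def
    by (rule order_trans[OF norm_triangle_ineq4 add_mono];
        rule order_trans[OF integral_norm_bound]) simp_all
  then show ?thesis by blast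
qed

lemma signed_integral_superposition:
  assumes \<mu>: "\<mu> \<in> M2" and N: "sigma_finite_measure N" and a: "integrable N a"
    and z[measurable]: "z \<in> borel_measurable N"
  shows "signed_integral borel \<mu> (superposition N a z) = (\<integral>\<omega>. a \<omega> * fourier_transform \<mu> (z \<omega>) \<partial>N)"
    and "signed_integral borel \<mu> (\<lambda>x. complex_of_real x * superposition N a z x) =
      (\<integral>\<omega>. a \<omega> * (\<i> * fourier_deriv \<mu> (z \<omega>)) \<partial>N)"
    and "integrable N (\<lambda>\<omega>. a \<omega> * (\<i> * fourier_deriv \<mu> (z \<omega>)))"
proof -
  let ?p = "pos_measure borel \<mu>" and ?n = "neg_measure borel \<mu>"
  have sf: "sigma_finite_measure ?p" "sigma_finite_measure ?n"
    using finite_measure_M2[OF \<mu>] by (auto simp: finite_measure_def)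
  have 1: "integrable ?p (\<lambda>x. 1::complex)" "integrable ?n (\<lambda>x. 1::complex)"
    by (rule integrable_M2_bounded[OF \<mu>, where C = 1]; simp)+
  have x: "integrable ?p complex_of_real" "integrable ?n complex_of_real"
    by (rule integrable_M2[OF \<mu>, where C = 1]; simp)+
  have sets: "sets ?p = sets borel" "sets ?n = sets borel" by simp_all
  note p1 = superposition_fubini[OF N sf(1) sets(1) a 1(1) z, unfolded mult_1_left]
    and n1 = superposition_fubini[OF N sf(2) sets(2) a 1(2) z, unfolded mult_1_left]
    and px = superposition_fubini[OF N sf(1) sets(1) a x(1) z]
    and nx = superposition_fubini[OF N sf(2) sets(2) a x(2) z]
  show "signed_integral borel \<mu> (superposition N a z) = (\<integral>\<omega>. a \<omega> * fourier_transform \<mu> (z \<omega>) \<partial>N)"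
    unfolding fourier_transform_eq signed_integral_def right_diff_distrib p1(1) n1(1)
    by (rule Bochner_Integration.integral_diff[OF p1(3) n1(3), symmetric])
  have *: "\<i> * fourier_deriv \<mu> \<xi> = signed_integral borel \<mu> (\<lambda>x. complex_of_real x * fchar \<xi> x)" for \<xi>
  proof -
    have "fourier_deriv \<mu> \<xi> = - \<i> * signed_integral borel \<mu> (\<lambda>x. complex_of_real x * fchar \<xi> x)"
      unfolding fourier_deriv_def signed_integral_def mult.assoc right_diff_distrib
      by (simp only: integral_mult_right_zero)
    then show ?thesis by simp
  qed
  show "signed_integral borel \<mu> (\<lambda>x. complex_of_real x * superposition N a z x) =
      (\<integral>\<omega>. a \<omega> * (\<i> * fourier_deriv \<mu> (z \<omega>)) \<partial>N)"
    unfolding * signed_integral_def right_diff_distrib px(1) nx(1)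
    by (rule Bochner_Integration.integral_diff[OF px(3) nx(3), symmetric])
  show "integrable N (\<lambda>\<omega>. a \<omega> * (\<i> * fourier_deriv \<mu> (z \<omega>)))"
    unfolding * signed_integral_def right_diff_distrib
    by (rule Bochner_Integration.integrable_diff[OF px(3) nx(3)])
qed
definition Hhat :: "real \<Rightarrow> complex" where
  "Hhat \<xi> = (\<integral>y. complex_of_real (H y) * fchar \<xi> y \<partial>lborel)"

lemma integrable_H: "integrable lborel (\<lambda>y. complex_of_real (H y))"
  using H_integral by (auto simp: has_bochner_integral_iff)

lemma norm_Hhat_le: "cmod (Hhat \<xi>) \<le> 1"
proof -
  have "cmod (Hhat \<xi>) \<le> (\<integral>y. cmod (complex_of_real (H y) * fchar \<xi> y) \<partial>lborel)"
    unfolding Hhat_def by (rule integral_norm_bound)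
  also have "\<dots> = 1"
    using H_integral by (simp add: norm_mult H_nonneg has_bochner_integral_iff)
  finally show ?thesis .
qed

lemma continuous_on_Hhat: "continuous_on UNIV Hhat"
  unfolding Hhat_def[abs_def]
proof (rule continuous_lebesgue_integral[where g = H])
  show "integrable lborel H"
    using H_integral by (auto simp: has_bochner_integral_iff)
  show "cmod (complex_of_real (H \<omega>) * fchar x \<omega>) \<le> H \<omega>" for x \<omega>
    by (simp add: norm_mult H_nonneg)
qed (measurable, intro continuous_intros)

lemma integrable_superposition_integrand:
  assumes a: "integrable N a" and [measurable]: "z \<in> borel_measurable N"
  shows "integrable N (\<lambda>\<omega>. a \<omega> * fchar (z \<omega>) x)"
  by (rule integrable_mult_bounded[OF a, where B = 1]) simp_all

lemma norm_superposition_le: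
  "cmod (superposition N a z x) \<le> (\<integral>\<omega>. cmod (a \<omega>) \<partial>N)"
  unfolding superposition_def
  by (rule order_trans[OF integral_norm_bound]) (simp add: norm_mult)

lemma continuous_on_superposition:
  assumes a: "integrable N a" and [measurable]: "z \<in> borel_measurable N"
  shows "continuous_on UNIV (superposition N a z)"
  unfolding superposition_def[abs_def]
proof (rule continuous_lebesgue_integral[where g = "\<lambda>\<omega>. cmod (a \<omega>)"])
  have [measurable]: "a \<in> borel_measurable N" using a by simp
  show "(\<lambda>\<omega>. a \<omega> * fchar (z \<omega>) x) \<in> borel_measurable N" for x by measurable
  show "continuous_on UNIV (\<lambda>x. a \<omega> * fchar (z \<omega>) x)" for \<omega>
    by (intro continuous_intros)
qed (use a in \<open>simp_all add: norm_mult\<close>)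

lemma has_vector_derivative_superposition:
  assumes a: "integrable N a" and za: "integrable N (\<lambda>\<omega>. z \<omega> * a \<omega>)"
    and z [measurable]: "z \<in> borel_measurable N"
  shows "(superposition N a z has_vector_derivative superposition N (\<lambda>\<omega>. - \<i> * (z \<omega> * a \<omega>)) z x) (at x)"
  unfolding superposition_def[abs_def]
proof (rule has_vector_derivative_lebesgue_integral[where g = "\<lambda>\<omega>. cmod (z \<omega> * a \<omega>)"
      and f = "\<lambda>x \<omega>. a \<omega> * fchar (z \<omega>) x" and f' = "\<lambda>x \<omega>. - \<i> * (z \<omega> * a \<omega>) * fchar (z \<omega>) x"])
  have [measurable]: "a \<in> borel_measurable N" using a by simp
  show "(\<lambda>\<omega>. - \<i> * (z \<omega> * a \<omega>) * fchar (z \<omega>) x) \<in> borel_measurable N" by measurable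
  show "((\<lambda>x. a \<omega> * fchar (z \<omega>) x) has_vector_derivative - \<i> * (z \<omega> * a \<omega>) * fchar (z \<omega>) x) (at x)" for x \<omega>
    using has_vector_derivative_mult_right[OF has_vector_derivative_fchar, of "a \<omega>" "z \<omega>" x UNIV]
    by (simp add: mult_ac)
  show "integrable N (\<lambda>\<omega>. cmod (z \<omega> * a \<omega>))"
    by (rule integrable_norm[OF za])
qed (simp_all add: norm_mult integrable_superposition_integrand[OF a z])

lemma signed_integral_bounded_linear:
  fixes L :: "complex \<Rightarrow> real"
  assumes L: "bounded_linear L"
    and "integrable (pos_measure borel \<mu>) f" "integrable (neg_measure borel \<mu>) f"
  shows "signed_integral borel \<mu> (\<lambda>x. L (f x)) = L (signed_integral borel \<mu> f)"
  unfolding signed_integral_def linear_diff[OF bounded_linear.linear[OF L]]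
  by (simp only: integral_bounded_linear[OF L assms(2)] integral_bounded_linear[OF L assms(3)])

context
  fixes N :: "'w measure" and a :: "'w \<Rightarrow> complex" and z :: "'w \<Rightarrow> real" and L :: "complex \<Rightarrow> real"
  assumes N: "sigma_finite_measure N"
    and a: "integrable N a" and za: "integrable N (\<lambda>\<omega>. z \<omega> * a \<omega>)"
    and z [measurable]: "z \<in> borel_measurable N" and L: "bounded_linear L"
begin

lemma superposition_real_deriv:
  "((\<lambda>x. L (superposition N a z x)) has_real_derivative
     L (superposition N (\<lambda>\<omega>. - \<i> * (z \<omega> * a \<omega>)) z x)) (at x)"
  using bounded_linear.has_vector_derivative[OF L has_vector_derivative_superposition[OF a za z]]
  by (simp only: has_real_derivative_iff_has_vector_derivative)

lemma deriv_superposition: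
  "deriv (\<lambda>x. L (superposition N a z x)) = (\<lambda>x. L (superposition N (\<lambda>\<omega>. - \<i> * (z \<omega> * a \<omega>)) z x))"
  using superposition_real_deriv by (intro ext DERIV_imp_deriv)

lemma superposition_C1b: "(\<lambda>x. L (superposition N a z x)) \<in> C1b"
proof -
  have za': "integrable N (\<lambda>\<omega>. - \<i> * (z \<omega> * a \<omega>))"
    using za by (intro integrable_mult_right) auto
  have bdd: "bounded (range (\<lambda>x. L (superposition N b z x)))" for b
  proof -
    have "bounded (range (superposition N b z))"
      using norm_superposition_le by (intro boundedI[where B = "\<integral>\<omega>. cmod (b \<omega>) \<partial>N"]) auto
    from bounded_linear_image[OF this L] show ?thesis by (simp add: image_image)
  qed
  show ?thesis
    unfolding C1b_def mem_Collect_eq deriv_superposition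
    using superposition_real_deriv bdd
    by (intro conjI allI bounded_linear.continuous_on[OF L] continuous_on_superposition za' z)
      (auto simp: real_differentiable_def)
qed

lemma weak_rhs_superposition:
  assumes \<mu>: "\<mu> \<in> M2" and mass: "signed_integral borel \<mu> (\<lambda>x. 1 :: real) = 0"
  shows "weak_rhs \<mu> (\<lambda>x. L (superposition N a z x)) =
      L (\<integral>\<omega>. a \<omega> * (1 / 4 * z \<omega> * fourier_deriv \<mu> (z \<omega>) - fourier_transform \<mu> (z \<omega>)
          + 2 * fourier_transform \<mu> (z \<omega> / 2) * Hhat (z \<omega> / 2)) \<partial>N)"
    and "integrable N (\<lambda>\<omega>. a \<omega> * (1 / 4 * z \<omega> * fourier_deriv \<mu> (z \<omega>) - fourier_transform \<mu> (z \<omega>)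
          + 2 * fourier_transform \<mu> (z \<omega> / 2) * Hhat (z \<omega> / 2)))"
proof -
  let ?p = "pos_measure borel \<mu>" and ?n = "neg_measure borel \<mu>"
  let ?F = "fourier_transform \<mu>" and ?F' = "fourier_deriv \<mu>"
  let ?\<Phi> = "superposition N a z" and ?\<Phi>' = "superposition N (\<lambda>\<omega>. - \<i> * (z \<omega> * a \<omega>)) z"
  interpret L: bounded_linear L by (rule L)
  have sf: "sigma_finite_measure ?p" "sigma_finite_measure ?n"
    using finite_measure_M2[OF \<mu>] by (auto simp: finite_measure_def)
  have za': "integrable N (\<lambda>\<omega>. - \<i> * (z \<omega> * a \<omega>))"
    using za by (intro integrable_mult_right) auto
  obtain V where V: "\<And>\<xi>. cmod (?F \<xi>) \<le> V" using bounded_fourier_transform[OF \<mu>] by blast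
  have [measurable]: "?F \<in> borel_measurable borel" "Hhat \<in> borel_measurable borel"
    using continuous_on_fourier_transform[OF \<mu>] continuous_on_Hhat
    by (auto intro: borel_measurable_continuous_onI)
  have [measurable]: "?\<Phi> \<in> borel_measurable borel"
    by (rule borel_measurable_continuous_onI[OF continuous_on_superposition[OF a z]])
  have z2: "(\<lambda>\<omega>. z \<omega> / 2) \<in> borel_measurable N" by measurable
  define b where "b \<omega> = a \<omega> * ?F (z \<omega> / 2)" for \<omega>
  have b: "integrable N b"
    unfolding b_def by (rule integrable_mult_bounded[OF a _ V]) simp
  have aF: "integrable N (\<lambda>\<omega>. a \<omega> * ?F (z \<omega>))"
    by (rule integrable_mult_bounded[OF a _ V]) simp
  have bH: "integrable N (\<lambda>\<omega>. b \<omega> * Hhat (z \<omega> / 2))"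
    by (rule integrable_mult_bounded[OF b _ norm_Hhat_le]) simp
  define K where "K = (\<integral>\<omega>. a \<omega> * ?F (z \<omega>) \<partial>N)"

  have xint: "integrable ?p (\<lambda>x. complex_of_real x * ?\<Phi>' x)" "integrable ?n (\<lambda>x. complex_of_real x * ?\<Phi>' x)"
  proof -
    have x: "integrable ?p complex_of_real" "integrable ?n complex_of_real"
      by (rule integrable_M2[OF \<mu>, where C = 1]; simp)+
    show "integrable ?p (\<lambda>x. complex_of_real x * ?\<Phi>' x)" "integrable ?n (\<lambda>x. complex_of_real x * ?\<Phi>' x)"
      by (rule superposition_fubini(2)[OF N sf(1) _ za' x(1) z] superposition_fubini(2)[OF N sf(2) _ za' x(2) z]; simp)+
  qed
  have Lx: "x * L w = L (complex_of_real x * w)" for x w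
    using L.scaleR[of x w] by (simp add: scaleR_conv_of_real)
  have half: "1 / 2 * L w = L (1 / 2 * w)" for w
    using Lx[of "1 / 2" w] by simp
  have quarter: "1 / 4 * L w = L (1 / 4 * w)" and two: "2 * L w = L (2 * w)" for w
    using Lx[of "1 / 4" w] Lx[of 2 w] by simp_all
  have drift_eq: "- \<i> * (z \<omega> * a \<omega>) * (\<i> * ?F' (z \<omega>)) = a \<omega> * (z \<omega> * ?F' (z \<omega>))" for \<omega>
    by (simp add: mult_ac)
  have drift: "signed_integral borel \<mu> (\<lambda>x. x * deriv (\<lambda>x. L (?\<Phi> x)) x) = L (\<integral>\<omega>. a \<omega> * (z \<omega> * ?F' (z \<omega>)) \<partial>N)"
    unfolding deriv_superposition Lx
    by (simp only: signed_integral_bounded_linear[OF L xint] signed_integral_superposition(2)[OF \<mu> N za' z] drift_eq)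
  have drift_int: "integrable N (\<lambda>\<omega>. a \<omega> * (z \<omega> * ?F' (z \<omega>)))"
    using signed_integral_superposition(3)[OF \<mu> N za' z] by (simp only: drift_eq)

  have gain: "signed_integral borel \<mu> (\<lambda>x. L (?\<Phi> ((x + y) / 2)) - 1 / 2 * L (?\<Phi> x) - 1 / 2 * L (?\<Phi> y)) =
      L (superposition N b (\<lambda>\<omega>. z \<omega> / 2) y - 1 / 2 * K)" for y
  proof -
    let ?a = "\<lambda>\<omega>. a \<omega> * fchar (z \<omega> / 2) y"
    have ia: "integrable N ?a" by (rule integrable_superposition_integrand[OF a z2])
    have mid: "?\<Phi> ((x + y) / 2) = superposition N ?a (\<lambda>\<omega>. z \<omega> / 2) x" for x
      by (simp add: superposition_def fchar_midpoint mult.assoc)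
    have bd: "integrable ?p (superposition N c w)" "integrable ?n (superposition N c w)"
      if "integrable N c" "w \<in> borel_measurable N" for c w
      by (rule integrable_M2_bounded[OF \<mu> _ norm_superposition_le];
        intro borel_measurable_continuous_onI continuous_on_superposition that)+
    have cst: "integrable ?p (\<lambda>x. c)" "integrable ?n (\<lambda>x. c)" for c :: complex
      by (rule integrable_M2_bounded[OF \<mu>, where C = "cmod c"]; simp)+
    have mass': "(\<integral>x. c \<partial>?p) - (\<integral>x. c \<partial>?n) = 0" for c :: complex
      using mass unfolding signed_integral_def by (simp flip: scaleR_diff_left)
    have S: "signed_integral borel \<mu> (superposition N ?a (\<lambda>\<omega>. z \<omega> / 2)) = superposition N b (\<lambda>\<omega>. z \<omega> / 2) y"
      unfolding signed_integral_superposition(1)[OF \<mu> N ia z2]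
      by (simp add: superposition_def b_def mult_ac)
    have e1: "(\<lambda>x. L (?\<Phi> ((x + y) / 2)) - 1 / 2 * L (?\<Phi> x) - 1 / 2 * L (?\<Phi> y)) =
        (\<lambda>x. L (superposition N ?a (\<lambda>\<omega>. z \<omega> / 2) x - 1 / 2 * ?\<Phi> x - 1 / 2 * ?\<Phi> y))"
      by (simp only: mid L.diff half)
    have e2: "signed_integral borel \<mu>
        (\<lambda>x. L (superposition N ?a (\<lambda>\<omega>. z \<omega> / 2) x - 1 / 2 * ?\<Phi> x - 1 / 2 * ?\<Phi> y))
      = L (signed_integral borel \<mu>
        (\<lambda>x. superposition N ?a (\<lambda>\<omega>. z \<omega> / 2) x - 1 / 2 * ?\<Phi> x - 1 / 2 * ?\<Phi> y))"
      by (intro signed_integral_bounded_linear L Bochner_Integration.integrable_diff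
          integrable_mult_right bd cst ia z2 a z)
    have e3: "signed_integral borel \<mu> (\<lambda>x. superposition N ?a (\<lambda>\<omega>. z \<omega> / 2) x - 1 / 2 * ?\<Phi> x - 1 / 2 * ?\<Phi> y)
        = signed_integral borel \<mu> (superposition N ?a (\<lambda>\<omega>. z \<omega> / 2)) - 1 / 2 * signed_integral borel \<mu> ?\<Phi>
          - ((\<integral>x. 1 / 2 * ?\<Phi> y \<partial>?p) - (\<integral>x. 1 / 2 * ?\<Phi> y \<partial>?n))"
    proof -
      have "(\<integral>x. superposition N ?a (\<lambda>\<omega>. z \<omega> / 2) x - 1 / 2 * ?\<Phi> x - 1 / 2 * ?\<Phi> y \<partial>P) =
        (\<integral>x. superposition N ?a (\<lambda>\<omega>. z \<omega> / 2) x \<partial>P) - 1 / 2 * (\<integral>x. ?\<Phi> x \<partial>P) - (\<integral>x. 1 / 2 * ?\<Phi> y \<partial>P)"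
        if A: "integrable P (superposition N ?a (\<lambda>\<omega>. z \<omega> / 2))" and B: "integrable P ?\<Phi>"
          and C: "integrable P (\<lambda>x. 1 / 2 * ?\<Phi> y)" for P
      proof -
        have B2: "integrable P (\<lambda>x. 1 / 2 * ?\<Phi> x)" using B by (rule integrable_mult_right)
        show ?thesis
          by (simp only: Bochner_Integration.integral_diff[OF Bochner_Integration.integrable_diff[OF A B2] C]
              Bochner_Integration.integral_diff[OF A B2] integral_mult_right_zero)
      qed
      note this[OF bd(1)[OF ia z2] bd(1)[OF a z] cst(1)] this[OF bd(2)[OF ia z2] bd(2)[OF a z] cst(2)]
      then show ?thesis
        unfolding signed_integral_def right_diff_distrib by (simp only: diff_diff_eq add_diff_eq diff_add_eq) (simp only: add_ac)
    qed
    show ?thesis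
      unfolding e1 e2 e3 mass' S K_def signed_integral_superposition(1)[OF \<mu> N a z] by simp
  qed

  have "(\<integral>y. signed_integral borel \<mu> (\<lambda>x. L (?\<Phi> ((x + y) / 2)) - 1 / 2 * L (?\<Phi> x) - 1 / 2 * L (?\<Phi> y)) * H y \<partial>lborel)
      = (\<integral>y. L (H y * superposition N b (\<lambda>\<omega>. z \<omega> / 2) y - H y * (1 / 2 * K)) \<partial>lborel)"
    unfolding gain using Lx[of "H _"] by (simp add: mult.commute[of "L _"] right_diff_distrib)
  also have "\<dots> = L (\<integral>y. H y * superposition N b (\<lambda>\<omega>. z \<omega> / 2) y - H y * (1 / 2 * K) \<partial>lborel)"
    by (intro integral_bounded_linear[OF L] Bochner_Integration.integrable_diff integrable_mult_left integrable_H
        superposition_fubini(2)[OF N lborel.sigma_finite_measure_axioms sets_lborel b integrable_H z2])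
  also have "(\<integral>y. H y * superposition N b (\<lambda>\<omega>. z \<omega> / 2) y - H y * (1 / 2 * K) \<partial>lborel)
      = (\<integral>\<omega>. b \<omega> * Hhat (z \<omega> / 2) \<partial>N) - 1 / 2 * K"
    by (subst Bochner_Integration.integral_diff)
      (simp_all add: superposition_fubini[OF N lborel.sigma_finite_measure_axioms sets_lborel b integrable_H z2]
        integrable_H has_bochner_integral_integral_eq[OF H_integral] Hhat_def del: of_real_mult)
  finally have coll: "(\<integral>y. signed_integral borel \<mu>
        (\<lambda>x. L (?\<Phi> ((x + y) / 2)) - 1 / 2 * L (?\<Phi> x) - 1 / 2 * L (?\<Phi> y)) * H y \<partial>lborel)
      = L ((\<integral>\<omega>. b \<omega> * Hhat (z \<omega> / 2) \<partial>N) - 1 / 2 * K)" .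

  let ?I = "\<lambda>\<omega>. a \<omega> * (1 / 4 * z \<omega> * ?F' (z \<omega>) - ?F (z \<omega>) + 2 * ?F (z \<omega> / 2) * Hhat (z \<omega> / 2))"
  have I: "?I = (\<lambda>\<omega>. 1 / 4 * (a \<omega> * (z \<omega> * ?F' (z \<omega>))) + 2 * (b \<omega> * Hhat (z \<omega> / 2)) - a \<omega> * ?F (z \<omega>))"
    by (simp add: b_def algebra_simps)
  show "integrable N ?I"
    unfolding I by (intro Bochner_Integration.integrable_diff Bochner_Integration.integrable_add
        integrable_mult_right drift_int bH aF)
  have int_I: "integral\<^sup>L N ?I = 1 / 4 * (\<integral>\<omega>. a \<omega> * (z \<omega> * ?F' (z \<omega>)) \<partial>N)
      + 2 * (\<integral>\<omega>. b \<omega> * Hhat (z \<omega> / 2) \<partial>N) - K"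
    unfolding I K_def using drift_int bH aF
    by (simp only: Bochner_Integration.integral_diff Bochner_Integration.integral_add
        Bochner_Integration.integrable_add integrable_mult_right integral_mult_right_zero)
  show "weak_rhs \<mu> (\<lambda>x. L (?\<Phi> x)) = L (integral\<^sup>L N ?I)"
    unfolding weak_rhs_def drift coll int_I quarter two L.add[symmetric]
    by (rule arg_cong[where f = L]) (simp add: algebra_simps)
qed

end
subsection \<open>Uniform boundedness and moving weights\<close>

lemma has_vector_derivative_quotientI:
  fixes f :: "real \<Rightarrow> 'b::real_normed_vector"
  assumes "((\<lambda>s. (f s - f t) /\<^sub>R (s - t)) \<longlongrightarrow> D) (at t within S)"
  shows "(f has_vector_derivative D) (at t within S)"
  unfolding has_vector_derivative_def has_derivative_at_within
proof (intro conjI)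
  have "((\<lambda>s. norm ((f s - f t) /\<^sub>R (s - t) - D)) \<longlongrightarrow> 0) (at t within S)"
    using assms by (simp add: tendsto_norm_zero_iff LIM_zero_iff)
  moreover have "\<forall>\<^sub>F s in at t within S. norm ((f s - f t) /\<^sub>R (s - t) - D) =
      norm ((f s - f t - (s - t) *\<^sub>R D) /\<^sub>R norm (s - t))"
    unfolding eventually_at_filter
  proof (intro always_eventually allI impI)
    fix s assume "s \<noteq> t"
    then have "(f s - f t) /\<^sub>R (s - t) - D = (f s - f t - (s - t) *\<^sub>R D) /\<^sub>R (s - t)"
      by (simp add: scaleR_diff_right)
    then show "norm ((f s - f t) /\<^sub>R (s - t) - D) = norm ((f s - f t - (s - t) *\<^sub>R D) /\<^sub>R norm (s - t))"
      by simp
  qed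
  ultimately have "((\<lambda>s. norm ((f s - f t - (s - t) *\<^sub>R D) /\<^sub>R norm (s - t))) \<longlongrightarrow> 0) (at t within S)"
    by (rule Lim_transform_eventually)
  then show "((\<lambda>s. (f s - f t - (s - t) *\<^sub>R D) /\<^sub>R norm (s - t)) \<longlongrightarrow> 0) (at t within S)"
    by (simp only: tendsto_norm_zero_iff)
qed (rule bounded_linear_scaleR_left)

lemma has_vector_derivative_moving_weight:
  fixes w g :: "real \<Rightarrow> real \<Rightarrow> complex"
  assumes w [measurable]: "\<And>s. 0 \<le> s \<Longrightarrow> w s \<in> borel_measurable borel"
    and g [measurable]: "\<And>s. 0 \<le> s \<Longrightarrow> g s \<in> borel_measurable borel"
    and w': "w' \<in> borel_measurable borel"
    and w_deriv: "\<And>\<eta>. ((\<lambda>s. w s \<eta>) has_vector_derivative w' \<eta>) (at t within {0..})"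
    and w_lip: "\<And>s \<eta>. s \<in> {0..t + 1} \<Longrightarrow> cmod (w s \<eta> - w t \<eta>) \<le> B * \<bar>s - t\<bar>"
    and w_supp: "\<And>s \<eta>. 0 \<le> s \<Longrightarrow> \<eta> \<notin> {0..2} \<Longrightarrow> w s \<eta> = 0"
    and g_cont: "\<And>\<eta>. continuous_on {0..} (\<lambda>s. g s \<eta>)"
    and g_bound: "\<And>s \<eta>. s \<in> {0..t + 1} \<Longrightarrow> \<eta> \<in> {0..2} \<Longrightarrow> cmod (g s \<eta>) \<le> C"
    and t: "0 \<le> t"
  shows "((\<lambda>s. \<integral>\<eta>. (w s \<eta> - w t \<eta>) * g s \<eta> \<partial>lborel) has_vector_derivative
      (\<integral>\<eta>. w' \<eta> * g t \<eta> \<partial>lborel)) (at t within {0..})"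
proof (rule has_vector_derivative_quotientI, unfold tendsto_at_iff_sequentially, intro allI impI)
  fix X :: "nat \<Rightarrow> real" assume X0: "\<forall>i. X i \<in> {0..} - {t}" and Xt: "X \<longlonglongrightarrow> t"
  let ?f = "\<lambda>s. \<integral>\<eta>. (w s \<eta> - w t \<eta>) * g s \<eta> \<partial>lborel"
  obtain i0 where "\<And>i. i0 \<le> i \<Longrightarrow> X i < t + 1"
    using order_tendstoD(2)[OF Xt, of "t + 1"] by (auto simp: eventually_sequentially)
  then have X: "X (i + i0) \<in> {0..t + 1}" "X (i + i0) \<noteq> t" for i
    using X0[rule_format, of "i + i0"] by (auto intro: less_imp_le)
  have Xt': "(\<lambda>i. X (i + i0)) \<longlonglongrightarrow> t" using Xt by (rule LIMSEQ_ignore_initial_segment)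
  have "(\<lambda>i. \<integral>\<eta>. ((w (X (i + i0)) \<eta> - w t \<eta>) /\<^sub>R (X (i + i0) - t)) * g (X (i + i0)) \<eta> \<partial>lborel)
      \<longlonglongrightarrow> (\<integral>\<eta>. w' \<eta> * g t \<eta> \<partial>lborel)"
  proof (rule integral_dominated_convergence[where w = "\<lambda>\<eta>. indicator {0..2} \<eta> * (B * C)"])
    show "(\<lambda>\<eta>. ((w (X (i + i0)) \<eta> - w t \<eta>) /\<^sub>R (X (i + i0) - t)) * g (X (i + i0)) \<eta>) \<in> borel_measurable lborel" for i
      using X(1)[of i] t by simp
    show "(\<lambda>\<eta>. w' \<eta> * g t \<eta>) \<in> borel_measurable lborel" using w' t by simp
    show "AE \<eta> in lborel. (\<lambda>i. ((w (X (i + i0)) \<eta> - w t \<eta>) /\<^sub>R (X (i + i0) - t)) * g (X (i + i0)) \<eta>)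
        \<longlonglongrightarrow> w' \<eta> * g t \<eta>"
    proof (intro AE_I2 tendsto_mult)
      fix \<eta>
      show "(\<lambda>i. g (X (i + i0)) \<eta>) \<longlonglongrightarrow> g t \<eta>"
        using X(1) t by (intro continuous_on_tendsto_compose[OF g_cont Xt']) auto
      have "((\<lambda>s. norm ((w s \<eta> - w t \<eta> - (s - t) *\<^sub>R w' \<eta>) /\<^sub>R norm (s - t))) \<longlongrightarrow> 0) (at t within {0..})"
        using w_deriv[of \<eta>]
        by (intro tendsto_norm_zero) (simp add: has_vector_derivative_def has_derivative_at_within)
      moreover have "filterlim (\<lambda>i. X (i + i0)) (at t within {0..}) sequentially"
        using X Xt' by (auto simp: filterlim_at)
      ultimately have "(\<lambda>i. norm ((w (X (i + i0)) \<eta> - w t \<eta> - (X (i + i0) - t) *\<^sub>R w' \<eta>) /\<^sub>R norm (X (i + i0) - t))) \<longlonglongrightarrow> 0"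
        by (rule filterlim_compose)
      also have "(\<lambda>i. norm ((w (X (i + i0)) \<eta> - w t \<eta> - (X (i + i0) - t) *\<^sub>R w' \<eta>) /\<^sub>R norm (X (i + i0) - t))) =
          (\<lambda>i. norm ((w (X (i + i0)) \<eta> - w t \<eta>) /\<^sub>R (X (i + i0) - t) - w' \<eta>))"
      proof
        fix i
        have "(w (X (i + i0)) \<eta> - w t \<eta>) /\<^sub>R (X (i + i0) - t) - w' \<eta> =
          (w (X (i + i0)) \<eta> - w t \<eta> - (X (i + i0) - t) *\<^sub>R w' \<eta>) /\<^sub>R (X (i + i0) - t)"
          using X(2)[of i] by (simp add: scaleR_diff_right)
        then show "norm ((w (X (i + i0)) \<eta> - w t \<eta> - (X (i + i0) - t) *\<^sub>R w' \<eta>) /\<^sub>R norm (X (i + i0) - t)) =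
          norm ((w (X (i + i0)) \<eta> - w t \<eta>) /\<^sub>R (X (i + i0) - t) - w' \<eta>)" by simp
      qed
      finally show "(\<lambda>i. (w (X (i + i0)) \<eta> - w t \<eta>) /\<^sub>R (X (i + i0) - t)) \<longlonglongrightarrow> w' \<eta>"
        by (simp only: tendsto_norm_zero_iff LIM_zero_iff)
    qed
    show "AE \<eta> in lborel. norm (((w (X (i + i0)) \<eta> - w t \<eta>) /\<^sub>R (X (i + i0) - t)) * g (X (i + i0)) \<eta>)
        \<le> indicator {0..2} \<eta> * (B * C)" for i
    proof (intro AE_I2)
      fix \<eta>
      show "norm (((w (X (i + i0)) \<eta> - w t \<eta>) /\<^sub>R (X (i + i0) - t)) * g (X (i + i0)) \<eta>)
        \<le> indicator {0..2} \<eta> * (B * C)"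
      proof (cases "\<eta> \<in> {0..2}")
        case True
        have "norm ((w (X (i + i0)) \<eta> - w t \<eta>) /\<^sub>R (X (i + i0) - t)) \<le> B"
          using w_lip[OF X(1)[of i], of \<eta>] X(2)[of i] unfolding norm_scaleR
          by (simp add: pos_divide_le_eq divide_inverse[symmetric] mult.commute[of "inverse _"])
        from mult_mono[OF this g_bound[OF X(1) True, of i] order_trans[OF norm_ge_zero this] norm_ge_zero]
        show ?thesis using True by (simp only: norm_mult) simp
      next
        case False
        then show ?thesis using w_supp X(1)[of i] t by simp
      qed
    qed
  qed simp
  then have "(\<lambda>i. ?f (X (i + i0)) /\<^sub>R (X (i + i0) - t)) \<longlonglongrightarrow> (\<integral>\<eta>. w' \<eta> * g t \<eta> \<partial>lborel)"
    by (simp only: mult_scaleR_left integral_scaleR_right)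
  then show "((\<lambda>s. (?f s - ?f t) /\<^sub>R (s - t)) \<circ> X) \<longlonglongrightarrow> (\<integral>\<eta>. w' \<eta> * g t \<eta> \<partial>lborel)"
    using LIMSEQ_offset[of "\<lambda>i. ?f (X i) /\<^sub>R (X i - t)" i0] by (simp add: o_def)
qed

lemma gliding_hump:
  fixes F :: "'s \<Rightarrow> 'x \<Rightarrow> complex"
  assumes max: "\<And>s. s \<in> A \<Longrightarrow> \<exists>\<xi>\<in>K. \<forall>\<eta>\<in>K. cmod (F s \<eta>) \<le> cmod (F s \<xi>)"
    and sums: "\<And>e \<xi>. (\<And>j::nat. \<xi> j \<in> K) \<Longrightarrow> (\<And>j. e j \<in> {1, - 1}) \<Longrightarrow>
      \<exists>B. \<forall>s\<in>A. cmod (\<Sum>j. e j * (1 / 3) ^ j * F s (\<xi> j)) \<le> B"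
  shows "\<exists>C. \<forall>s\<in>A. \<forall>\<xi>\<in>K. cmod (F s \<xi>) \<le> C"
proof (rule ccontr)
  assume "\<not> ?thesis"
  then have "\<exists>s \<xi>. s \<in> A \<and> \<xi> \<in> K \<and> 4 ^ n < cmod (F s \<xi>) \<and> (\<forall>\<eta>\<in>K. cmod (F s \<eta>) \<le> cmod (F s \<xi>))" for n
    using max by (meson less_le_trans not_le)
  then obtain s \<xi> where s: "\<And>n::nat. s n \<in> A" and \<xi>: "\<And>n. \<xi> n \<in> K"
    and big: "\<And>n. 4 ^ n < cmod (F (s n) (\<xi> n))"
    and top: "\<And>n \<eta>. \<eta> \<in> K \<Longrightarrow> cmod (F (s n) \<eta>) \<le> cmod (F (s n) (\<xi> n))"
    by metis
  have sign: "\<exists>e\<in>{1, - 1}. cmod w \<le> cmod (v + e * w)" for v w :: complex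
  proof (rule ccontr)
    assume "\<not> ?thesis"
    then have "cmod (v + w) < cmod w" "cmod (v - w) < cmod w" by (auto simp: not_le)
    then show False using norm_triangle_ineq4[of "v + w" "v - w"] by (simp add: norm_mult)
  qed
  txt \<open>
    The signs are chosen recursively so that the \<open>n\<close>-th partial sum at \<open>s n\<close> is at least as large as
    its last term. Since \<open>\<xi> n\<close> maximises \<open>|F (s n)|\<close>, the remaining terms amount to at most half of it.
  \<close>
  have "\<exists>G :: nat \<Rightarrow> 's \<Rightarrow> complex. \<forall>n. (n = 0 \<longrightarrow> G n = (\<lambda>_. 0)) \<and>
      (\<exists>e\<in>{1, - 1}. G (Suc n) = (\<lambda>t. G n t + e * (1 / 3) ^ n * F t (\<xi> n)) \<and>
        (1 / 3) ^ n * cmod (F (s n) (\<xi> n)) \<le> cmod (G (Suc n) (s n)))"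
  proof (intro dependent_nat_choice)
    fix G :: "'s \<Rightarrow> complex" and n
    obtain e where e: "e \<in> {1, - 1}" "cmod ((1 / 3) ^ n * F (s n) (\<xi> n)) \<le> cmod (G (s n) + e * ((1 / 3) ^ n * F (s n) (\<xi> n)))"
      using sign by blast
    then show "\<exists>G'. (Suc n = 0 \<longrightarrow> G' = (\<lambda>_. 0)) \<and>
      (\<exists>e\<in>{1, - 1}. G' = (\<lambda>t. G t + e * (1 / 3) ^ n * F t (\<xi> n)) \<and>
        (1 / 3) ^ n * cmod (F (s n) (\<xi> n)) \<le> cmod (G' (s n)))"
      by (intro exI[of _ "\<lambda>t. G t + e * (1 / 3) ^ n * F t (\<xi> n)"])
        (auto simp: norm_mult norm_power mult.assoc)
  qed auto
  then obtain G where "G 0 = (\<lambda>_. 0)"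
    and "\<forall>n. \<exists>e\<in>{1, - 1}. G (Suc n) = (\<lambda>t. G n t + e * (1 / 3) ^ n * F t (\<xi> n)) \<and>
        (1 / 3) ^ n * cmod (F (s n) (\<xi> n)) \<le> cmod (G (Suc n) (s n))"
    by blast
  then obtain e where G0: "G 0 = (\<lambda>_. 0)" and e: "\<And>n. e n \<in> {1, - 1}"
    and GS: "\<And>n. G (Suc n) = (\<lambda>t. G n t + e n * (1 / 3) ^ n * F t (\<xi> n))"
    and hump: "\<And>n. (1 / 3) ^ n * cmod (F (s n) (\<xi> n)) \<le> cmod (G (Suc n) (s n))"
    by metis
  have G: "G n t = (\<Sum>j<n. e j * (1 / 3) ^ j * F t (\<xi> j))" for n t
    by (induction n) (simp_all add: G0 GS)
  obtain B where B: "\<And>t. t \<in> A \<Longrightarrow> cmod (\<Sum>j. e j * (1 / 3) ^ j * F t (\<xi> j)) \<le> B"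
    using sums[of \<xi> e] \<xi> e by blast
  have "(4 / 3) ^ n \<le> 2 * B" for n
  proof -
    let ?M = "cmod (F (s n) (\<xi> n))" and ?f = "\<lambda>j. e j * (1 / 3) ^ j * F (s n) (\<xi> j)"
    have term_le: "cmod (?f j) \<le> (1 / 3) ^ j * ?M" for j
    proof -
      have "cmod (e j) = 1" using e[of j] by auto
      then show ?thesis using top[OF \<xi>] by (simp add: norm_mult norm_power)
    qed
    have geo: "(\<lambda>j. (1 / 3) ^ j * ?M) sums (3 / 2 * ?M)"
      using sums_mult2[OF geometric_sums[of "1 / 3 :: real"], of ?M] by simp
    have summ: "summable (\<lambda>j. cmod (?f j))"
      using term_le by (intro summable_comparison_test'[OF sums_summable[OF geo], of 0]) simp
    have tail_geo: "(\<lambda>j. (1 / 3) ^ (j + Suc n) * ?M) sums ((1 / 3) ^ n * ?M / 2)"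
      using sums_mult2[OF geo, of "(1 / 3) ^ Suc n"] by (simp add: power_add mult_ac)
    have tail_summ: "summable (\<lambda>j. cmod (?f (j + Suc n)))"
      using summable_ignore_initial_segment[OF summ] .
    have "cmod (\<Sum>j. ?f (j + Suc n)) \<le> (\<Sum>j. cmod (?f (j + Suc n)))"
      by (rule summable_norm[OF tail_summ])
    also have "\<dots> \<le> (1 / 3) ^ n * ?M / 2"
      using suminf_le[OF term_le tail_summ sums_summable[OF tail_geo]] sums_unique[OF tail_geo] by simp
    finally have tail: "cmod (\<Sum>j. ?f (j + Suc n)) \<le> (1 / 3) ^ n * ?M / 2" .
    have "suminf ?f = (\<Sum>j. ?f (j + Suc n)) + G (Suc n) (s n)"
      unfolding G by (rule suminf_split_initial_segment[OF summable_norm_cancel[OF summ]])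
    then have "cmod (G (Suc n) (s n)) \<le> cmod (suminf ?f) + cmod (\<Sum>j. ?f (j + Suc n))"
      using norm_triangle_ineq4[of "suminf ?f" "\<Sum>j. ?f (j + Suc n)"] by simp
    with hump[of n] tail B[OF s, of n] have "(1 / 3) ^ n * ?M \<le> 2 * B" by linarith
    moreover have "(4 / 3) ^ n = (1 / 3) ^ n * (4::real) ^ n" by (simp flip: power_mult_distrib)
    moreover have "\<dots> \<le> (1 / 3) ^ n * ?M" using big[of n] by (intro mult_left_mono) auto
    ultimately show ?thesis by linarith
  qed
  then show False
    using real_arch_pow[of "4 / 3" "2 * B"] by (force simp: not_le[symmetric])
qed

lemma signed_integral_cong_borel:
  assumes "\<And>A. A \<in> sets borel \<Longrightarrow> \<mu> A = \<nu> A"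
  shows "signed_integral borel \<mu> = signed_integral borel \<nu>"
proof -
  have "upper_variation borel \<mu> = upper_variation borel \<nu>"
    "upper_variation borel (\<lambda>A. - \<mu> A) = upper_variation borel (\<lambda>A. - \<nu> A)"
    unfolding upper_variation_def[abs_def] using assms by (auto intro!: ext SUP_cong)
  then show ?thesis
    unfolding signed_integral_def[abs_def] neg_measure_def pos_measure_def by simp
qed

subsection \<open>Local boundedness of the Fourier transform\<close>

locale linearised_solution =
  fixes h :: "real \<Rightarrow> real set \<Rightarrow> real" and h0 :: "real set \<Rightarrow> real"
  assumes sol: "weak_solution h h0"
    and mass0: "signed_integral borel h0 (\<lambda>x. 1 :: real) = 0"
begin

abbreviation F :: "real \<Rightarrow> real \<Rightarrow> complex" where "F t \<equiv> fourier_transform (h t)"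

lemma solution_M2: "0 \<le> t \<Longrightarrow> h t \<in> M2"
  using sol by (simp add: weak_solution_def)

lemma solution_deriv:
  "\<phi> \<in> C1b \<Longrightarrow> 0 \<le> t \<Longrightarrow>
    ((\<lambda>s. signed_integral borel (h s) \<phi>) has_real_derivative weak_rhs (h t) \<phi>) (at t within {0..})"
  using sol by (simp add: weak_solution_def)

lemma fourier_transform_initial: "F 0 = fourier_transform h0"
proof -
  have "signed_integral borel (h 0) = (signed_integral borel h0 :: (real \<Rightarrow> complex) \<Rightarrow> complex)"
    by (rule signed_integral_cong_borel) (use sol in \<open>simp add: weak_solution_def\<close>)
  then show ?thesis by (simp add: fourier_transform_def[abs_def])
qed

lemma mass_conserved:
  assumes "0 \<le> t"
  shows "signed_integral borel (h t) (\<lambda>x. 1 :: real) = 0"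
proof -
  have C: "(\<lambda>x. 1) \<in> C1b" by (auto simp: C1b_def)
  have rhs: "weak_rhs \<mu> (\<lambda>x. 1) = 0" for \<mu>
    by (simp add: weak_rhs_def signed_integral_def)
  have "\<exists>c. \<forall>s\<in>{0..}. signed_integral borel (h s) (\<lambda>x. 1 :: real) = c"
  proof (rule has_field_derivative_zero_constant)
    show "((\<lambda>s. signed_integral borel (h s) (\<lambda>x. 1 :: real)) has_field_derivative 0) (at s within {0..})"
      if "s \<in> {0..}" for s
      using solution_deriv[OF C, of s] that by (simp add: rhs)
  qed simp
  then have "signed_integral borel (h t) (\<lambda>x. 1 :: real) = signed_integral borel (h 0) (\<lambda>x. 1 :: real)"
    using assms by force
  also have "signed_integral borel (h 0) = (signed_integral borel h0 :: (real \<Rightarrow> real) \<Rightarrow> real)"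
    by (rule signed_integral_cong_borel) (use sol in \<open>simp add: weak_solution_def\<close>)
  finally show ?thesis using mass0 by simp
qed

lemma fourier_superposition_deriv:
  assumes N: "sigma_finite_measure N" and a: "integrable N a"
    and za: "integrable N (\<lambda>\<omega>. complex_of_real (z \<omega>) * a \<omega>)"
    and z: "z \<in> borel_measurable N" and t: "0 \<le> t"
  shows "((\<lambda>s. \<integral>\<omega>. a \<omega> * F s (z \<omega>) \<partial>N) has_vector_derivative
      (\<integral>\<omega>. a \<omega> * (complex_of_real (1 / 4 * z \<omega>) * fourier_deriv (h t) (z \<omega>) - F t (z \<omega>)
          + 2 * F t (z \<omega> / 2) * Hhat (z \<omega> / 2)) \<partial>N)) (at t within {0..})" (is "(?f has_vector_derivative ?D) _")
    and "integrable N (\<lambda>\<omega>. a \<omega> * (complex_of_real (1 / 4 * z \<omega>) * fourier_deriv (h t) (z \<omega>) - F t (z \<omega>)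
          + 2 * F t (z \<omega> / 2) * Hhat (z \<omega> / 2)))"
proof -
  have "((\<lambda>s. L (?f s)) has_real_derivative L ?D) (at t within {0..})" if L: "bounded_linear L" for L
  proof (rule has_field_derivative_transform_within[OF _ zero_less_one])
    show "((\<lambda>s. signed_integral borel (h s) (\<lambda>x. L (superposition N a z x))) has_real_derivative L ?D)
        (at t within {0..})"
      using solution_deriv[OF superposition_C1b[OF N a za z L] t]
      by (simp only: weak_rhs_superposition(1)[OF N a za z L solution_M2[OF t] mass_conserved[OF t]])
    show "signed_integral borel (h s) (\<lambda>x. L (superposition N a z x)) = L (?f s)" if "s \<in> {0..}" for s
    proof -
      have s: "h s \<in> M2" using that solution_M2 by simp
      have "integrable (pos_measure borel (h s)) (superposition N a z)"
        "integrable (neg_measure borel (h s)) (superposition N a z)"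
        by (rule integrable_M2_bounded[OF s _ norm_superposition_le];
          intro borel_measurable_continuous_onI continuous_on_superposition a z)+
      from signed_integral_bounded_linear[OF L this] show ?thesis
        by (simp only: signed_integral_superposition(1)[OF s N a z])
    qed
  qed (use t in auto)
  from this[OF bounded_linear_Re] this[OF bounded_linear_Im]
  show "(?f has_vector_derivative ?D) (at t within {0..})"
    by (simp only: has_vector_derivative_complex_iff)
  show "integrable N (\<lambda>\<omega>. a \<omega> * (complex_of_real (1 / 4 * z \<omega>) * fourier_deriv (h t) (z \<omega>) - F t (z \<omega>)
          + 2 * F t (z \<omega> / 2) * Hhat (z \<omega> / 2)))"
    by (rule weak_rhs_superposition(2)[OF N a za z bounded_linear_Re solution_M2[OF t] mass_conserved[OF t]])
qed

lemma fourier_locally_bounded: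
  "\<exists>C. \<forall>s\<in>{0..T}. \<forall>\<xi>\<in>{- R..R}. cmod (F s \<xi>) \<le> C"
proof (cases "0 \<le> R")
  case True
  show ?thesis
  proof (rule gliding_hump)
    fix s assume "s \<in> {0..T}"
    then have "continuous_on {- R..R} (\<lambda>\<xi>. cmod (F s \<xi>))"
      using solution_M2 by (intro continuous_intros continuous_on_fourier_transform) auto
    from continuous_attains_sup[OF compact_Icc _ this] True
    show "\<exists>\<xi>\<in>{- R..R}. \<forall>\<eta>\<in>{- R..R}. cmod (F s \<eta>) \<le> cmod (F s \<xi>)" by auto
  next
    fix e :: "nat \<Rightarrow> complex" and \<xi> :: "nat \<Rightarrow> real" assume \<xi>: "\<And>j. \<xi> j \<in> {- R..R}" and e: "\<And>j. e j \<in> {1, - 1}"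
    let ?N = "count_space (UNIV :: nat set)" and ?a = "\<lambda>j. e j * (1 / 3) ^ j"
    have N: "sigma_finite_measure ?N" by (rule sigma_finite_measure_count_space)
    have ne: "cmod (e j) = 1" for j using e[of j] by auto
    have a: "integrable ?N ?a"
      by (simp add: integrable_count_space_nat_iff norm_mult norm_power ne)
    have z: "\<xi> \<in> borel_measurable ?N" by simp
    have za: "integrable ?N (\<lambda>j. complex_of_real (\<xi> j) * ?a j)"
    proof -
      have "cmod (complex_of_real (\<xi> j)) \<le> R" for j using \<xi>[of j] by (simp add: abs_le_iff)
      from integrable_mult_bounded[OF a _ this] show ?thesis by (simp add: mult.commute)
    qed
    have "continuous_on {0..} (\<lambda>s. \<integral>j. ?a j * F s (\<xi> j) \<partial>?N)"
      using fourier_superposition_deriv(1)[OF N a za z]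
      by (auto simp: continuous_on_eq_continuous_within intro: has_vector_derivative_continuous)
    then have "continuous_on {0..T} (\<lambda>s. \<integral>j. ?a j * F s (\<xi> j) \<partial>?N)"
      by (rule continuous_on_subset) auto
    then have "bounded ((\<lambda>s. \<integral>j. ?a j * F s (\<xi> j) \<partial>?N) ` {0..T})"
      by (intro compact_imp_bounded compact_continuous_image) auto
    then obtain B where B: "\<And>s. s \<in> {0..T} \<Longrightarrow> cmod (\<integral>j. ?a j * F s (\<xi> j) \<partial>?N) \<le> B"
      unfolding bounded_iff by blast
    have "(\<integral>j. ?a j * F s (\<xi> j) \<partial>?N) = (\<Sum>j. ?a j * F s (\<xi> j))" if s: "s \<in> {0..T}" for s
    proof (rule integral_count_space_nat)
      obtain V where "\<And>\<xi>. cmod (F s \<xi>) \<le> V"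
        using bounded_fourier_transform[OF solution_M2, of s] s by auto
      then show "integrable ?N (\<lambda>j. ?a j * F s (\<xi> j))"
        by (intro integrable_mult_bounded[OF a]) auto
    qed
    with B show "\<exists>B. \<forall>s\<in>{0..T}. cmod (\<Sum>j. e j * (1 / 3) ^ j * F s (\<xi> j)) \<le> B" by metis
  qed
qed (use not_le in auto)

lemma continuous_on_fourier_time: "continuous_on {0..} (\<lambda>s. F s \<xi>)"
proof -
  let ?N = "count_space (UNIV :: unit set)"
  have "((\<lambda>s. \<integral>\<omega>. 1 * F s \<xi> \<partial>?N) has_vector_derivative
      (\<integral>\<omega>. 1 * (complex_of_real (1 / 4 * \<xi>) * fourier_deriv (h t) \<xi> - F t \<xi>
          + 2 * F t (\<xi> / 2) * Hhat (\<xi> / 2)) \<partial>?N)) (at t within {0..})" if "0 \<le> t" for t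
    using that
    by (intro fourier_superposition_deriv sigma_finite_measure_count_space_finite)
      (auto simp: integrable_count_space)
  then show ?thesis
    by (auto simp: continuous_on_eq_continuous_within lebesgue_integral_count_space_finite
        intro: has_vector_derivative_continuous)
qed

end
subsection \<open>Duhamel's formula along characteristics\<close>

lemma integrable_compact_support:
  fixes f :: "real \<Rightarrow> 'b::{banach, second_countable_topology}"
  assumes "continuous_on UNIV f" "\<And>x. x \<notin> {a..b} \<Longrightarrow> f x = 0"
  shows "integrable lborel f"
proof -
  have "integrable lborel (\<lambda>x. indicator {a..b} x *\<^sub>R f x)"
    using assms(1) by (intro borel_integrable_compact continuous_on_subset[OF assms(1)]) auto
  moreover have "(\<lambda>x. indicator {a..b} x *\<^sub>R f x) = f"
    using assms(2) by (auto simp: indicator_def)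
  ultimately show ?thesis by simp
qed

locale profile =
  fixes \<rho> \<rho>' :: "real \<Rightarrow> real"
  assumes deriv: "\<And>x. (\<rho> has_real_derivative \<rho>' x) (at x)"
    and cont: "continuous_on UNIV \<rho>'"
    and supp: "\<And>x. x \<notin> {1..2} \<Longrightarrow> \<rho> x = 0" "\<And>x. x \<notin> {1..2} \<Longrightarrow> \<rho>' x = 0"
begin

lemma cont_profile: "continuous_on A \<rho>"
  by (meson DERIV_isCont continuous_at_imp_continuous_on deriv)

definition weight :: "real \<Rightarrow> real \<Rightarrow> real" where
  "weight s \<eta> = exp (s / 4) * \<rho> (\<eta> * exp (s / 4))"

definition weight' :: "real \<Rightarrow> real \<Rightarrow> real" where
  "weight' s \<eta> = 1 / 4 * exp (s / 4) * (\<rho> (\<eta> * exp (s / 4)) + \<eta> * exp (s / 4) * \<rho>' (\<eta> * exp (s / 4)))"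

lemma weight_deriv: "((\<lambda>s. weight s \<eta>) has_real_derivative weight' s \<eta>) (at s within A)"
proof -
  have e: "((\<lambda>s. exp (s / 4)) has_real_derivative exp (s / 4) / 4) (at s within A)"
    by (auto intro!: derivative_eq_intros)
  from DERIV_mult'[OF e DERIV_chain'[OF DERIV_cmult[OF e, of \<eta>] deriv]] show ?thesis
    unfolding weight_def weight'_def by (simp add: algebra_simps)
qed

lemma weight_deriv_space:
  "((\<lambda>\<eta>. \<eta> * weight s \<eta>) has_real_derivative 4 * weight' s \<eta>) (at \<eta> within A)"
proof -
  from DERIV_mult'[OF DERIV_ident DERIV_cmult[OF DERIV_chain'[OF DERIV_cmult_right[OF DERIV_ident, of "exp (s / 4)"] deriv], of "exp (s / 4)"]]
  show ?thesis
    unfolding weight_def weight'_def by (simp add: algebra_simps)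
qed

lemma weight_supp:
  assumes "0 \<le> s" "\<eta> \<notin> {0..2}"
  shows "weight s \<eta> = 0" "weight' s \<eta> = 0"
proof -
  have "\<eta> * exp (s / 4) \<notin> {1..2}"
  proof (cases "\<eta> < 0")
    case True
    then have "\<eta> * exp (s / 4) < 0" by (simp add: mult_neg_pos)
    then show ?thesis by auto
  next
    case False
    then have "2 < \<eta>" using assms by auto
    moreover have "1 \<le> exp (s / 4)" using assms by simp
    ultimately have "2 < \<eta> * exp (s / 4)" using mult_left_mono[of 1 "exp (s / 4)" \<eta>] by linarith
    then show ?thesis by auto
  qed
  then show "weight s \<eta> = 0" "weight' s \<eta> = 0"
    by (simp_all add: weight_def weight'_def supp)
qed

lemma cont_weight: "continuous_on A (weight s)" "continuous_on A (weight' s)"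
  unfolding weight_def[abs_def] weight'_def[abs_def]
  by (intro continuous_intros continuous_on_compose2[OF cont_profile[of UNIV]] continuous_on_compose2[OF cont]; simp)+

lemma weight_lipschitz:
  "\<exists>B. \<forall>s\<in>{0..T}. \<forall>t\<in>{0..T}. \<forall>\<eta>. \<bar>weight s \<eta> - weight t \<eta>\<bar> \<le> B * \<bar>s - t\<bar>"
proof -
  have "continuous_on {1..2} (\<lambda>x. \<rho> x + x * \<rho>' x)"
    by (intro continuous_intros cont_profile continuous_on_subset[OF cont]) auto
  from compact_imp_bounded[OF compact_continuous_image[OF this compact_Icc]]
  have "\<exists>K. \<forall>x\<in>{1..2}. \<bar>\<rho> x + x * \<rho>' x\<bar> \<le> K"
    unfolding bounded_iff ball_simps real_norm_def .
  then obtain K where K: "\<And>x. x \<in> {1..2} \<Longrightarrow> \<bar>\<rho> x + x * \<rho>' x\<bar> \<le> K"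
    by blast
  have K0: "0 \<le> K" by (rule order_trans[OF abs_ge_zero K[of 1]]) simp
  have K': "\<bar>\<rho> x + x * \<rho>' x\<bar> \<le> K" for x
    using K[of x] K0 supp[of x] by (cases "x \<in> {1..2}") auto
  define B where "B = 1 / 4 * exp (T / 4) * K"
  have "\<bar>weight' s \<eta>\<bar> \<le> B" if "s \<in> {0..T}" for s \<eta>
    unfolding weight'_def B_def abs_mult using that K'[of "\<eta> * exp (s / 4)"] K0
    by (intro mult_mono) auto
  then have "\<bar>weight s \<eta> - weight t \<eta>\<bar> \<le> B * \<bar>s - t\<bar>" if "s \<in> {0..T}" "t \<in> {0..T}" for s t \<eta>
    using field_differentiable_bound[of "{0..T}" "\<lambda>s. weight s \<eta>" "\<lambda>s. weight' s \<eta>" B s t]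
      weight_deriv that by auto
  then show ?thesis by blast
qed

end

locale solution_profile = linearised_solution + profile
begin

text \<open>
  In \<open>\<partial>\<^sub>t F = \<xi>/4 \<partial>\<^sub>\<xi> F - F + \<dots>\<close> the transport term is absorbed by the motion of the weight:
  the two derivatives add up to the integral of a total derivative in \<open>\<eta>\<close>.
\<close>

lemma averaged_deriv:
  assumes t: "0 \<le> t"
  shows "((\<lambda>s. \<integral>\<eta>. complex_of_real (weight s \<eta>) * F s (\<eta> * \<xi>) \<partial>lborel) has_vector_derivative
    (\<integral>\<eta>. complex_of_real (weight t \<eta>) * (2 * F t (\<eta> * \<xi> / 2) * Hhat (\<eta> * \<xi> / 2) - F t (\<eta> * \<xi>)) \<partial>lborel))
    (at t within {0..})" (is "(?G has_vector_derivative ?D) _")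
proof -
  let ?F' = "fourier_deriv (h t)"
  let ?w = "\<lambda>s \<eta>. complex_of_real (weight s \<eta>)"
  have cF: "continuous_on UNIV (\<lambda>\<eta>. F s (c \<eta>))" if "0 \<le> s" "continuous_on UNIV c" for s c
    using continuous_on_compose2[OF continuous_on_fourier_transform[OF solution_M2[OF that(1)], of UNIV] that(2)] by simp
  have cF': "continuous_on UNIV (\<lambda>\<eta>. ?F' (\<eta> * \<xi>))"
    by (intro continuous_on_compose2[OF continuous_on_fourier_deriv[OF solution_M2[OF t]]] continuous_intros) auto
  have cH: "continuous_on UNIV (\<lambda>\<eta>. Hhat (\<eta> * \<xi> / 2))"
    by (intro continuous_on_compose2[OF continuous_on_Hhat] continuous_intros) auto
  note cw = cont_weight[of UNIV]
  have cs: "integrable lborel (\<lambda>\<eta>. ?w s \<eta> * f \<eta>)" "integrable lborel (\<lambda>\<eta>. complex_of_real (weight' s \<eta>) * f \<eta>)"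
    if "0 \<le> s" "continuous_on UNIV f" for s f
    by (rule integrable_compact_support[where a = 0 and b = 2, OF continuous_on_mult[OF continuous_on_of_real[OF cw(1)] that(2)]]
        integrable_compact_support[where a = 0 and b = 2, OF continuous_on_mult[OF continuous_on_of_real[OF cw(2)] that(2)]];
      simp add: weight_supp[OF that(1)])+
  have a: "integrable lborel (?w t)" using cs(1)[OF t, of "\<lambda>_. 1"] by simp
  have za: "integrable lborel (\<lambda>\<eta>. complex_of_real (\<eta> * \<xi>) * ?w t \<eta>)"
  proof -
    have "continuous_on UNIV (\<lambda>\<eta>. complex_of_real (\<eta> * \<xi>))" by (intro continuous_intros)
    from cs(1)[OF t this] show ?thesis
      by (simp only: mult.commute[of "complex_of_real (weight t _)"])
  qed
  note A = fourier_superposition_deriv[OF lborel.sigma_finite_measure_axioms a za _ t]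
  let ?I = "\<lambda>\<eta>. ?w t \<eta> * (complex_of_real (1 / 4 * (\<eta> * \<xi>)) * ?F' (\<eta> * \<xi>) - F t (\<eta> * \<xi>)
      + 2 * F t (\<eta> * \<xi> / 2) * Hhat (\<eta> * \<xi> / 2))"
  have A: "((\<lambda>s. \<integral>\<eta>. ?w t \<eta> * F s (\<eta> * \<xi>) \<partial>lborel) has_vector_derivative integral\<^sup>L lborel ?I) (at t within {0..})"
    "integrable lborel ?I"
    by (rule A; simp)+
  obtain B where B: "\<And>s r \<eta>. s \<in> {0..t + 1} \<Longrightarrow> r \<in> {0..t + 1} \<Longrightarrow> \<bar>weight s \<eta> - weight r \<eta>\<bar> \<le> B * \<bar>s - r\<bar>"
    using weight_lipschitz[of "t + 1"] by blast
  obtain C where C: "\<And>s \<eta>. s \<in> {0..t + 1} \<Longrightarrow> \<eta> \<in> {- (2 * \<bar>\<xi>\<bar>)..2 * \<bar>\<xi>\<bar>} \<Longrightarrow> cmod (F s \<eta>) \<le> C"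
    using fourier_locally_bounded[of "t + 1" "2 * \<bar>\<xi>\<bar>"] by blast
  have MB: "((\<lambda>s. \<integral>\<eta>. (?w s \<eta> - ?w t \<eta>) * F s (\<eta> * \<xi>) \<partial>lborel) has_vector_derivative
      (\<integral>\<eta>. complex_of_real (weight' t \<eta>) * F t (\<eta> * \<xi>) \<partial>lborel)) (at t within {0..})"
  proof (rule has_vector_derivative_moving_weight[where B = B and C = C])
    show "?w s \<in> borel_measurable borel" "(\<lambda>\<eta>. complex_of_real (weight' t \<eta>)) \<in> borel_measurable borel" for s
      by (intro borel_measurable_continuous_onI continuous_intros cw)+
    show "(\<lambda>\<eta>. F s (\<eta> * \<xi>)) \<in> borel_measurable borel" if "0 \<le> s" for s
      by (intro borel_measurable_continuous_onI cF that continuous_intros)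
    show "((\<lambda>s. ?w s \<eta>) has_vector_derivative complex_of_real (weight' t \<eta>)) (at t within {0..})" for \<eta>
      using has_vector_derivative_of_real[OF weight_deriv] .
    show "cmod (?w s \<eta> - ?w t \<eta>) \<le> B * \<bar>s - t\<bar>" if "s \<in> {0..t + 1}" for s \<eta>
      using B[OF that, of t \<eta>] t by (simp flip: of_real_diff)
    show "cmod (F s (\<eta> * \<xi>)) \<le> C" if "s \<in> {0..t + 1}" "\<eta> \<in> {0..2}" for s \<eta>
    proof (rule C[OF that(1)])
      have "\<bar>\<eta> * \<xi>\<bar> \<le> 2 * \<bar>\<xi>\<bar>" using that(2) by (simp add: abs_mult mult_right_mono)
      then show "\<eta> * \<xi> \<in> {- (2 * \<bar>\<xi>\<bar>)..2 * \<bar>\<xi>\<bar>}" by (simp add: abs_le_iff)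
    qed
    show "continuous_on {0..} (\<lambda>s. F s (\<eta> * \<xi>))" for \<eta> by (rule continuous_on_fourier_time)
  qed (use weight_supp(1) t in auto)
  let ?J' = "\<lambda>\<eta>. complex_of_real (4 * weight' t \<eta>) * F t (\<eta> * \<xi>) + complex_of_real (\<eta> * weight t \<eta>) * (\<xi> * ?F' (\<eta> * \<xi>))"
  have J: "((\<lambda>\<eta>. complex_of_real (\<eta> * weight t \<eta>) * F t (\<eta> * \<xi>)) has_vector_derivative ?J' \<eta>) (at \<eta> within {0..3})" for \<eta>
  proof -
    have lin: "((\<lambda>\<eta>. \<eta> * \<xi>) has_real_derivative \<xi>) (at \<eta> within {0..3})" by (auto intro!: derivative_eq_intros)
    have "((\<lambda>\<eta>. F t (\<eta> * \<xi>)) has_vector_derivative \<xi> *\<^sub>R ?F' (\<eta> * \<xi>)) (at \<eta> within {0..3})"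
      using vector_diff_chain_within[OF lin[unfolded has_real_derivative_iff_has_vector_derivative]
        has_vector_derivative_at_within[OF has_vector_derivative_fourier_transform[OF solution_M2[OF t]]]]
      by (simp add: o_def)
    from has_vector_derivative_mult[OF has_vector_derivative_of_real[OF
        weight_deriv_space] this]
    show ?thesis by (simp add: scaleR_conv_of_real add.commute)
  qed
  have cJ: "continuous_on UNIV ?J'"
    by (intro continuous_intros cw cF cF' t)
  have "(\<integral>\<eta>. indicator {0..3} \<eta> *\<^sub>R ?J' \<eta> \<partial>lborel) =
      complex_of_real (3 * weight t 3) * F t (3 * \<xi>) - complex_of_real (0 * weight t 0) * F t (0 * \<xi>)"
    by (rule integral_FTC_Icc[OF _ J continuous_on_subset[OF cJ]]) auto
  also have "\<dots> = 0" using weight_supp(1)[OF t, of 3] by simp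
  also have "(\<lambda>\<eta>. indicator {0..3} \<eta> *\<^sub>R ?J' \<eta>) = ?J'"
  proof
    fix \<eta> show "indicator {0..3} \<eta> *\<^sub>R ?J' \<eta> = ?J' \<eta>"
      by (cases "\<eta> \<in> {0..3}") (use weight_supp[OF t, of \<eta>] in auto)
  qed
  finally have J0: "integral\<^sup>L lborel ?J' = 0" .
  have iW: "integrable lborel (\<lambda>\<eta>. complex_of_real (weight' t \<eta>) * F t (\<eta> * \<xi>))"
    by (intro cs(2) t cF continuous_intros)
  let ?S = "\<lambda>\<eta>. ?w t \<eta> * (2 * F t (\<eta> * \<xi> / 2) * Hhat (\<eta> * \<xi> / 2) - F t (\<eta> * \<xi>))"
  have iS: "integrable lborel ?S"
    by (intro cs(1) t cF cH continuous_intros) auto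
  have iJ: "integrable lborel ?J'"
    using weight_supp[OF t] by (intro integrable_compact_support[OF cJ, where a = 0 and b = 2]) auto
  have "integral\<^sup>L lborel ?I + (\<integral>\<eta>. complex_of_real (weight' t \<eta>) * F t (\<eta> * \<xi>) \<partial>lborel)
      = (\<integral>\<eta>. ?I \<eta> + complex_of_real (weight' t \<eta>) * F t (\<eta> * \<xi>) \<partial>lborel)"
    by (rule Bochner_Integration.integral_add[OF A(2) iW, symmetric])
  also have "\<dots> = (\<integral>\<eta>. ?S \<eta> + 1 / 4 * ?J' \<eta> \<partial>lborel)"
    by (rule Bochner_Integration.integral_cong[OF refl]) (simp add: algebra_simps)
  also have "\<dots> = ?D + 1 / 4 * integral\<^sup>L lborel ?J'"
    using Bochner_Integration.integral_add[OF iS integrable_mult_right[OF iJ], of "1 / 4"] by (simp only: integral_mult_right_zero)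
  also have "\<dots> = ?D" by (simp only: J0) simp
  finally have D: "integral\<^sup>L lborel ?I + (\<integral>\<eta>. complex_of_real (weight' t \<eta>) * F t (\<eta> * \<xi>) \<partial>lborel) = ?D" .
  show ?thesis
  proof (rule has_vector_derivative_transform[OF _ _ has_vector_derivative_add[OF A(1) MB, unfolded D]])
    fix s :: real assume s: "s \<in> {0..}"
    then have "integrable lborel (\<lambda>\<eta>. ?w s \<eta> * F s (\<eta> * \<xi>))"
      by (intro cs(1) cF continuous_intros) auto
    moreover have "integrable lborel (\<lambda>\<eta>. ?w t \<eta> * F s (\<eta> * \<xi>))"
      using s by (intro cs(1) cF continuous_intros t) auto
    ultimately show "?G s = (\<integral>\<eta>. ?w t \<eta> * F s (\<eta> * \<xi>) \<partial>lborel) + (\<integral>\<eta>. (?w s \<eta> - ?w t \<eta>) * F s (\<eta> * \<xi>) \<partial>lborel)"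
      by (simp add: left_diff_distrib)
  qed (use t in simp)
qed

end
context linearised_solution
begin

definition g :: "real \<Rightarrow> real \<Rightarrow> complex" where
  "g s \<xi> = complex_of_real (exp s) * F s (\<xi> * exp (- (s / 4)))"

definition R :: "real \<Rightarrow> real \<Rightarrow> complex" where
  "R s \<xi> = 2 * g s (\<xi> / 2) * Hhat (\<xi> * exp (- (s / 4)) / 2)"

lemma continuous_on_g: "0 \<le> s \<Longrightarrow> continuous_on A (g s)"
  unfolding g_def[abs_def]
  by (intro continuous_intros continuous_on_compose2[OF continuous_on_fourier_transform[OF solution_M2, of s UNIV]]) auto

lemma continuous_on_R:
  assumes "0 \<le> s"
  shows "continuous_on A (R s)"
  unfolding R_def[abs_def]
  by (intro continuous_on_mult continuous_on_const continuous_on_compose2[OF continuous_on_g[OF assms, of UNIV]]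
      continuous_on_compose2[OF continuous_on_Hhat] continuous_intros) auto

lemma g_locally_bounded: "\<exists>C. \<forall>s\<in>{0..T}. \<forall>\<xi>\<in>{- r..r}. cmod (g s \<xi>) \<le> C"
proof -
  obtain C where C: "\<And>s \<xi>. s \<in> {0..T} \<Longrightarrow> \<xi> \<in> {- r..r} \<Longrightarrow> cmod (F s \<xi>) \<le> C"
    using fourier_locally_bounded[of T r] by blast
  have "cmod (g s \<xi>) \<le> exp T * C" if s: "s \<in> {0..T}" and \<xi>: "\<xi> \<in> {- r..r}" for s \<xi>
  proof -
    have "\<bar>\<xi>\<bar> * exp (- (s / 4)) \<le> r * 1"
      using s \<xi> by (intro mult_mono) auto
    then have "\<bar>\<xi> * exp (- (s / 4))\<bar> \<le> r" by (simp add: abs_mult)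
    then have "\<xi> * exp (- (s / 4)) \<in> {- r..r}" by (simp add: abs_le_iff)
    from C[OF s this] show ?thesis
      using s by (auto simp: g_def norm_mult intro!: mult_mono)
  qed
  then show ?thesis by blast
qed

lemma norm_R_le: "cmod (R s \<xi>) \<le> 2 * cmod (g s (\<xi> / 2))"
  using norm_Hhat_le[of "\<xi> * exp (- (s / 4)) / 2"]
  by (simp add: R_def norm_mult mult_left_le)

end

context solution_profile
begin

lemma averaged_g_deriv:
  assumes t: "0 \<le> t"
  shows "((\<lambda>s. \<integral>\<eta>. complex_of_real (\<rho> \<eta>) * g s (\<eta> * \<xi>) \<partial>lborel) has_vector_derivative
    (\<integral>\<eta>. complex_of_real (\<rho> \<eta>) * R t (\<eta> * \<xi>) \<partial>lborel)) (at t within {0..})"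
proof -
  let ?G = "\<lambda>s. \<integral>\<eta>. complex_of_real (weight s \<eta>) * F s (\<eta> * \<xi>) \<partial>lborel"
  let ?S = "\<lambda>\<eta>. 2 * F t (\<eta> * \<xi> / 2) * Hhat (\<eta> * \<xi> / 2) - F t (\<eta> * \<xi>)"
  have subst: "complex_of_real (exp s) * (\<integral>\<eta>. complex_of_real (weight s \<eta>) * f \<eta> \<partial>lborel)
      = (\<integral>\<eta>. complex_of_real (\<rho> \<eta>) * (complex_of_real (exp s) * f (\<eta> * exp (- (s / 4)))) \<partial>lborel)" for s f
  proof -
    have *: "\<bar>exp (- (s / 4))\<bar> *\<^sub>R (complex_of_real (weight s (0 + exp (- (s / 4)) * \<eta>)) * f (0 + exp (- (s / 4)) * \<eta>))
        = complex_of_real (\<rho> \<eta>) * f (\<eta> * exp (- (s / 4)))" for \<eta>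
    proof -
      have 1: "exp (- (s / 4)) * exp (s / 4) = 1" by (simp flip: exp_add)
      have "exp (- (s / 4)) * weight s (exp (- (s / 4)) * \<eta>) =
          (exp (- (s / 4)) * exp (s / 4)) * \<rho> ((exp (- (s / 4)) * exp (s / 4)) * \<eta>)"
        by (simp add: weight_def mult_ac)
      also have "\<dots> = \<rho> \<eta>" unfolding 1 by simp
      finally have "complex_of_real (exp (- (s / 4))) * complex_of_real (weight s (exp (- (s / 4)) * \<eta>)) = complex_of_real (\<rho> \<eta>)"
        by (simp only: of_real_mult[symmetric])
      then show ?thesis
        by (simp add: scaleR_conv_of_real mult.assoc[symmetric] mult.commute[of \<eta>] del: of_real_exp exp_of_real)
    qed
    have "(\<integral>\<eta>. complex_of_real (weight s \<eta>) * f \<eta> \<partial>lborel) = (\<integral>\<eta>. complex_of_real (\<rho> \<eta>) * f (\<eta> * exp (- (s / 4))) \<partial>lborel)"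
      by (subst lborel_integral_real_affine[of "exp (- (s / 4))" _ 0])
        (simp, simp only: integral_scaleR_right[symmetric] *)
    moreover have "complex_of_real (\<rho> \<eta>) * (complex_of_real (exp s) * f (\<eta> * exp (- (s / 4)))) =
        complex_of_real (exp s) * (complex_of_real (\<rho> \<eta>) * f (\<eta> * exp (- (s / 4))))" for \<eta>
      by (simp add: mult_ac)
    ultimately show ?thesis
      by (simp only: integral_mult_right_zero)
  qed
  have "((\<lambda>s. complex_of_real (exp s)) has_vector_derivative complex_of_real (exp t)) (at t within {0..})"
    by (rule has_vector_derivative_of_real[OF has_field_derivative_at_within[OF DERIV_exp]])
  from has_vector_derivative_mult[OF this averaged_deriv[OF t, of \<xi>]]
  have D: "((\<lambda>s. complex_of_real (exp s) * ?G s) has_vector_derivative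
      complex_of_real (exp t) * (\<integral>\<eta>. complex_of_real (weight t \<eta>) * ?S \<eta> \<partial>lborel) + complex_of_real (exp t) * ?G t) (at t within {0..})" .
  have cF: "continuous_on UNIV (\<lambda>\<eta>. F t (c \<eta>))" if "continuous_on UNIV c" for c
    using continuous_on_compose2[OF continuous_on_fourier_transform[OF solution_M2[OF t], of UNIV] that] by simp
  have cH: "continuous_on UNIV (\<lambda>\<eta>. Hhat (\<eta> * \<xi> / 2))"
    by (intro continuous_on_compose2[OF continuous_on_Hhat] continuous_intros) auto
  have int: "integrable lborel (\<lambda>\<eta>. complex_of_real (weight t \<eta>) * f \<eta>)" if "continuous_on UNIV f" for f
    by (rule integrable_compact_support[where a = 0 and b = 2, OF continuous_on_mult[OF continuous_on_of_real[OF cont_weight(1)] that]])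
      (simp add: weight_supp[OF t])
  have "complex_of_real (exp t) * (\<integral>\<eta>. complex_of_real (weight t \<eta>) * ?S \<eta> \<partial>lborel) + complex_of_real (exp t) * ?G t =
      complex_of_real (exp t) * (\<integral>\<eta>. complex_of_real (weight t \<eta>) * ?S \<eta> + complex_of_real (weight t \<eta>) * F t (\<eta> * \<xi>) \<partial>lborel)"
    by (subst Bochner_Integration.integral_add) (auto intro!: int cF cH continuous_intros simp: distrib_left)
  also have "\<dots> = complex_of_real (exp t) * (\<integral>\<eta>. complex_of_real (weight t \<eta>) * (2 * F t (\<eta> * \<xi> / 2) * Hhat (\<eta> * \<xi> / 2)) \<partial>lborel)"
    by (simp add: distrib_left[symmetric])
  also have "\<dots> = (\<integral>\<eta>. complex_of_real (\<rho> \<eta>) * R t (\<eta> * \<xi>) \<partial>lborel)"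
    unfolding subst by (simp add: R_def g_def mult_ac)
  finally have eq: "complex_of_real (exp t) * (\<integral>\<eta>. complex_of_real (weight t \<eta>) * ?S \<eta> \<partial>lborel) + complex_of_real (exp t) * ?G t
      = (\<integral>\<eta>. complex_of_real (\<rho> \<eta>) * R t (\<eta> * \<xi>) \<partial>lborel)" .
  have "(\<lambda>s. complex_of_real (exp s) * ?G s) = (\<lambda>s. \<integral>\<eta>. complex_of_real (\<rho> \<eta>) * g s (\<eta> * \<xi>) \<partial>lborel)"
    unfolding subst by (simp add: g_def mult_ac)
  with D show ?thesis by (simp only: eq)
qed

end
lemma (in profile) profile_rescaled:
  assumes "1 \<le> n"
  shows "profile (\<lambda>x. n * \<rho> (1 + n * (x - 1))) (\<lambda>x. n * (\<rho>' (1 + n * (x - 1)) * n))"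
proof
  show "((\<lambda>x. n * \<rho> (1 + n * (x - 1))) has_real_derivative n * (\<rho>' (1 + n * (x - 1)) * n)) (at x)" for x
  proof (intro DERIV_cmult DERIV_chain'[where g = \<rho>] deriv)
    show "((\<lambda>x. 1 + n * (x - 1)) has_real_derivative n) (at x)"
      by (auto intro!: derivative_eq_intros)
  qed
  show "continuous_on UNIV (\<lambda>x. n * (\<rho>' (1 + n * (x - 1)) * n))"
    by (intro continuous_intros continuous_on_compose2[OF cont]) auto
  have *: "1 + n * (x - 1) \<notin> {1..2}" if "x \<notin> {1..2}" for x
  proof (cases "x < 1")
    case True
    then have "n * (x - 1) < 0" using assms by (intro mult_pos_neg) auto
    then show ?thesis by auto
  next
    case False
    then have "1 < x - 1" using that by auto
    also have "x - 1 \<le> n * (x - 1)"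
      using mult_right_mono[of 1 n "x - 1"] assms False by simp
    finally have "1 < n * (x - 1)" .
    then show ?thesis by auto
  qed
  show "n * \<rho> (1 + n * (x - 1)) = 0" "n * (\<rho>' (1 + n * (x - 1)) * n) = 0" if "x \<notin> {1..2}" for x
    using supp[OF *[OF that]] by simp_all
qed

lemma (in profile) rescaled_profile_integral:
  fixes f :: "real \<Rightarrow> complex"
  assumes "0 < n"
  shows "(\<integral>\<eta>. complex_of_real (n * \<rho> (1 + n * (\<eta> - 1))) * f \<eta> \<partial>lborel)
    = (\<integral>v. complex_of_real (\<rho> v) * f (1 + (v - 1) / n) \<partial>lborel)"
proof -
  have "(\<integral>v. complex_of_real (\<rho> v) * f (1 + (v - 1) / n) \<partial>lborel)
      = \<bar>n\<bar> *\<^sub>R (\<integral>\<eta>. complex_of_real (\<rho> ((1 - n) + n * \<eta>)) * f (1 + ((1 - n) + n * \<eta> - 1) / n) \<partial>lborel)"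
    using assms by (intro lborel_integral_real_affine) simp
  also have "\<dots> = (\<integral>\<eta>. \<bar>n\<bar> *\<^sub>R (complex_of_real (\<rho> ((1 - n) + n * \<eta>)) * f (1 + ((1 - n) + n * \<eta> - 1) / n)) \<partial>lborel)"
    by (rule integral_scaleR_right[symmetric])
  also have "\<dots> = (\<integral>\<eta>. complex_of_real (n * \<rho> (1 + n * (\<eta> - 1))) * f \<eta> \<partial>lborel)"
  proof (rule Bochner_Integration.integral_cong[OF refl])
    fix \<eta>
    have "1 + ((1 - n) + n * \<eta> - 1) / n = \<eta>" "(1 - n) + n * \<eta> = 1 + n * (\<eta> - 1)"
      using assms by (auto simp: field_simps)
    then show "\<bar>n\<bar> *\<^sub>R (complex_of_real (\<rho> ((1 - n) + n * \<eta>)) * f (1 + ((1 - n) + n * \<eta> - 1) / n))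
        = complex_of_real (n * \<rho> (1 + n * (\<eta> - 1))) * f \<eta>"
      using assms by (simp only: abs_of_pos scaleR_conv_of_real of_real_mult mult.assoc)
  qed
  finally show ?thesis by simp
qed

context profile
begin

lemma rescaled_average_bound:
  fixes f :: "real \<Rightarrow> complex"
  assumes "\<And>\<eta>. \<eta> \<in> {- (2 * \<bar>\<xi>\<bar>)..2 * \<bar>\<xi>\<bar>} \<Longrightarrow> cmod (f \<eta>) \<le> B" "1 \<le> n"
  shows "cmod (complex_of_real (\<rho> v) * f ((1 + (v - 1) / n) * \<xi>)) \<le> \<bar>\<rho> v\<bar> * B"
proof (cases "v \<in> {1..2}")
  case True
  then have "0 \<le> (v - 1) / n" "(v - 1) / n \<le> 1" using assms(2) by (auto simp: field_simps)
  then have "\<bar>(1 + (v - 1) / n) * \<xi>\<bar> \<le> 2 * \<bar>\<xi>\<bar>"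
    unfolding abs_mult by (intro mult_right_mono) auto
  then have "cmod (f ((1 + (v - 1) / n) * \<xi>)) \<le> B" by (intro assms(1)) (simp add: abs_le_iff)
  then show ?thesis by (simp add: norm_mult mult_left_mono)
qed (simp add: supp)

lemma integrable_profile: "integrable lborel \<rho>"
  using supp by (intro integrable_compact_support[where a = 1 and b = 2] cont_profile) auto

lemma rescaled_average_tendsto:
  fixes f :: "real \<Rightarrow> complex"
  assumes f: "continuous_on UNIV f"
  shows "(\<lambda>n. \<integral>v. complex_of_real (\<rho> v) * f ((1 + (v - 1) / real (Suc n)) * \<xi>) \<partial>lborel)
    \<longlonglongrightarrow> (\<integral>v. complex_of_real (\<rho> v) \<partial>lborel) * f \<xi>"
proof -
  have "bounded (f ` {- (2 * \<bar>\<xi>\<bar>)..2 * \<bar>\<xi>\<bar>})"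
    by (intro compact_imp_bounded compact_continuous_image continuous_on_subset[OF f]) auto
  then obtain B where B: "\<And>\<eta>. \<eta> \<in> {- (2 * \<bar>\<xi>\<bar>)..2 * \<bar>\<xi>\<bar>} \<Longrightarrow> cmod (f \<eta>) \<le> B"
    unfolding bounded_iff by blast
  have meas: "(\<lambda>v. complex_of_real (\<rho> v) * f (c v)) \<in> borel_measurable borel" if "continuous_on UNIV c" for c
    by (intro borel_measurable_continuous_onI continuous_on_mult continuous_on_of_real cont_profile
        continuous_on_compose2[OF f that]) auto
  have "(\<lambda>n. \<integral>v. complex_of_real (\<rho> v) * f ((1 + (v - 1) / real (Suc n)) * \<xi>) \<partial>lborel)
    \<longlonglongrightarrow> (\<integral>v. complex_of_real (\<rho> v) * f \<xi> \<partial>lborel)"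
  proof (rule integral_dominated_convergence[where w = "\<lambda>v. \<bar>\<rho> v\<bar> * B"])
    show "(\<lambda>v. complex_of_real (\<rho> v) * f \<xi>) \<in> borel_measurable lborel"
      using meas[of "\<lambda>_. \<xi>"] by simp
    show "(\<lambda>v. complex_of_real (\<rho> v) * f ((1 + (v - 1) / real (Suc n)) * \<xi>)) \<in> borel_measurable lborel" for n
    proof -
      have "continuous_on UNIV (\<lambda>v. (1 + (v - 1) / real (Suc n)) * \<xi>)"
        by (intro continuous_intros) auto
      from meas[OF this] show ?thesis by simp
    qed
    show "integrable lborel (\<lambda>v. \<bar>\<rho> v\<bar> * B)"
      using integrable_profile by simp
    show "AE v in lborel. (\<lambda>n. complex_of_real (\<rho> v) * f ((1 + (v - 1) / real (Suc n)) * \<xi>)) \<longlonglongrightarrow> complex_of_real (\<rho> v) * f \<xi>"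
    proof (intro AE_I2 tendsto_mult tendsto_const)
      fix v
      have "(\<lambda>n. (1 + (v - 1) * inverse (real (Suc n))) * \<xi>) \<longlonglongrightarrow> (1 + (v - 1) * 0) * \<xi>"
        by (intro tendsto_intros LIMSEQ_inverse_real_of_nat)
      then have "(\<lambda>n. (1 + (v - 1) / real (Suc n)) * \<xi>) \<longlonglongrightarrow> \<xi>"
        by (simp add: divide_inverse)
      then show "(\<lambda>n. f ((1 + (v - 1) / real (Suc n)) * \<xi>)) \<longlonglongrightarrow> f \<xi>"
        by (rule continuous_on_tendsto_compose[OF f]) auto
    qed
    show "AE v in lborel. cmod (complex_of_real (\<rho> v) * f ((1 + (v - 1) / real (Suc n)) * \<xi>)) \<le> \<bar>\<rho> v\<bar> * B" for n
      by (intro AE_I2 rescaled_average_bound B) auto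
  qed
  then show ?thesis by (simp only: integral_mult_left_zero)
qed

end

lemma (in solution_profile) duhamel_profile:
  assumes t: "0 \<le> t" and nz: "(\<integral>v. complex_of_real (\<rho> v) \<partial>lborel) \<noteq> 0"
  shows "((\<lambda>s. R s \<xi>) has_integral g t \<xi> - g 0 \<xi>) {0..t}"
proof -
  let ?M = "\<lambda>f n. \<integral>v. complex_of_real (\<rho> v) * f ((1 + (v - 1) / real (Suc n)) * \<xi>) \<partial>lborel"
  let ?I = "\<integral>v. complex_of_real (\<rho> v) \<partial>lborel"
  have FTC: "((\<lambda>s. ?M (R s) n) has_integral ?M (g t) n - ?M (g 0) n) {0..t}" for n
  proof (rule fundamental_theorem_of_calculus[OF t])
    fix s assume s: "s \<in> {0..t}"
    interpret sc: profile "\<lambda>x. real (Suc n) * \<rho> (1 + real (Suc n) * (x - 1))"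
      "\<lambda>x. real (Suc n) * (\<rho>' (1 + real (Suc n) * (x - 1)) * real (Suc n))"
      by (rule profile_rescaled) simp
    interpret scs: solution_profile h h0 "\<lambda>x. real (Suc n) * \<rho> (1 + real (Suc n) * (x - 1))"
      "\<lambda>x. real (Suc n) * (\<rho>' (1 + real (Suc n) * (x - 1)) * real (Suc n))"
      by unfold_locales
    have "((\<lambda>s. ?M (g s) n) has_vector_derivative ?M (R s) n) (at s within {0..})"
      using scs.averaged_g_deriv[of s \<xi>] s
      by (simp only: rescaled_profile_integral[of "real (Suc n)"] atLeastAtMost_iff of_nat_0_less_iff zero_less_Suc)
    then show "((\<lambda>s. ?M (g s) n) has_vector_derivative ?M (R s) n) (at s within {0..t})"
      by (rule has_vector_derivative_within_subset) auto
  qed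
  obtain C where C: "\<And>s \<eta>. s \<in> {0..t} \<Longrightarrow> \<eta> \<in> {- \<bar>\<xi>\<bar>..\<bar>\<xi>\<bar>} \<Longrightarrow> cmod (g s \<eta>) \<le> C"
    using g_locally_bounded[of t "\<bar>\<xi>\<bar>"] by blast
  have RB: "cmod (R s \<eta>) \<le> 2 * C" if "s \<in> {0..t}" "\<eta> \<in> {- (2 * \<bar>\<xi>\<bar>)..2 * \<bar>\<xi>\<bar>}" for s \<eta>
    using norm_R_le[of s \<eta>] C[OF that(1), of "\<eta> / 2"] that(2) by auto
  have I: "((\<lambda>s. ?I * R s \<xi>) has_integral ?I * g t \<xi> - ?I * g 0 \<xi>) {0..t}"
  proof (rule has_integral_dominated_convergence[OF FTC, where h = "\<lambda>_. (\<integral>v. \<bar>\<rho> v\<bar> \<partial>lborel) * (2 * C)"])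
    show "\<forall>s\<in>{0..t}. cmod (?M (R s) n) \<le> (\<integral>v. \<bar>\<rho> v\<bar> \<partial>lborel) * (2 * C)" for n
    proof
      fix s assume s: "s \<in> {0..t}"
      have "cmod (?M (R s) n) \<le> (\<integral>v. \<bar>\<rho> v\<bar> * (2 * C) \<partial>lborel)"
      proof (rule order_trans[OF integral_norm_bound integral_mono'])
        show "integrable lborel (\<lambda>v. \<bar>\<rho> v\<bar> * (2 * C))" using integrable_profile by simp
        show bound: "cmod (complex_of_real (\<rho> v) * R s ((1 + (v - 1) / real (Suc n)) * \<xi>)) \<le> \<bar>\<rho> v\<bar> * (2 * C)" for v
          by (intro rescaled_average_bound RB[OF s]) auto
        show "0 \<le> \<bar>\<rho> v\<bar> * (2 * C)" for v
          by (rule order_trans[OF norm_ge_zero bound])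
      qed
      then show "cmod (?M (R s) n) \<le> (\<integral>v. \<bar>\<rho> v\<bar> \<partial>lborel) * (2 * C)"
        by (simp only: integral_mult_left_zero)
    qed
    show "\<forall>s\<in>{0..t}. (\<lambda>n. ?M (R s) n) \<longlonglongrightarrow> ?I * R s \<xi>"
      by (intro ballI rescaled_average_tendsto continuous_on_R) auto
    show "(\<lambda>n. ?M (g t) n - ?M (g 0) n) \<longlonglongrightarrow> ?I * g t \<xi> - ?I * g 0 \<xi>"
      using t by (intro tendsto_diff rescaled_average_tendsto continuous_on_g) auto
  qed (rule integrable_const_ivl)
  have inv: "inverse ?I * (?I * w) = w" for w
    unfolding mult.assoc[symmetric] left_inverse[OF nz] by (rule mult_1_left)
  show ?thesis
    using has_integral_mult_right[OF I, of "inverse ?I"]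
    by (simp only: right_diff_distrib[symmetric] inv)
qed

definition bump :: "real \<Rightarrow> real" where
  "bump x = (max 0 ((x - 1) * (2 - x)))\<^sup>2"

lemma profile_bump: "profile bump (\<lambda>x. 2 * max 0 ((x - 1) * (2 - x)) * (3 - 2 * x))"
proof
  have sq: "((\<lambda>u. (max 0 u)\<^sup>2) has_real_derivative 2 * max 0 u) (at u)" for u :: real
  proof -
    consider "u < 0" | "u = 0" | "u > 0" by linarith
    then show ?thesis
    proof cases
      case 1
      have "((\<lambda>u. 0) has_real_derivative 2 * max 0 u) (at u)" using 1 by simp
      then show ?thesis
        by (rule has_field_derivative_transform_within_open[where S = "{..<0}"]) (use 1 in auto)
    next
      case 2
      have "((\<lambda>v. (max 0 v)\<^sup>2 / v) \<longlongrightarrow> 0) (at (0::real))"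
      proof (rule Lim_null_comparison)
        have "norm ((max 0 v)\<^sup>2 / v) \<le> \<bar>v\<bar>" for v :: real
          by (cases "v \<le> 0") (auto simp: power2_eq_square max_def)
        then show "\<forall>\<^sub>F v in at (0::real). norm ((max 0 v)\<^sup>2 / v) \<le> \<bar>v\<bar>" by simp
        show "(abs \<longlongrightarrow> 0) (at (0::real))"
          using tendsto_rabs[OF tendsto_ident_at[of "0::real" UNIV]] by simp
      qed
      then show ?thesis using 2 by (simp add: has_field_derivative_iff)
    next
      case 3
      have "((\<lambda>u. u\<^sup>2) has_real_derivative 2 * max 0 u) (at u)"
        using 3 by (auto intro!: derivative_eq_intros)
      then show ?thesis
        by (rule has_field_derivative_transform_within_open[where S = "{0<..}"]) (use 3 in auto)
    qed
  qed
  show "(bump has_real_derivative 2 * max 0 ((x - 1) * (2 - x)) * (3 - 2 * x)) (at x)" for x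
    unfolding bump_def[abs_def]
  proof (rule DERIV_chain'[OF _ sq, THEN DERIV_cong])
    show "((\<lambda>x. (x - 1) * (2 - x)) has_real_derivative 3 - 2 * x) (at x)"
      by (auto intro!: derivative_eq_intros)
  qed simp
  have "(x - 1) * (2 - x) \<le> 0" if "x \<notin> {1..2}" for x :: real
    using that by (cases "x < 1") (auto intro: mult_nonpos_nonneg mult_nonneg_nonpos)
  then show "bump x = 0" "2 * max 0 ((x - 1) * (2 - x)) * (3 - 2 * x) = 0" if "x \<notin> {1..2}" for x
    using that by (auto simp: bump_def max_absorb1)
qed (auto intro!: continuous_intros)

lemma integral_bump_nonzero: "(\<integral>v. complex_of_real (bump v) \<partial>lborel) \<noteq> 0"
proof -
  interpret profile bump "\<lambda>x. 2 * max 0 ((x - 1) * (2 - x)) * (3 - 2 * x)" by (rule profile_bump)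
  have "(1 / 9)\<^sup>2 \<le> bump x" if "x \<in> {4 / 3..5 / 3}" for x
  proof -
    have "1 / 3 * (1 / 3) \<le> (x - 1) * (2 - x)" using that by (intro mult_mono) auto
    then show ?thesis unfolding bump_def by (intro power_mono) auto
  qed
  then have le: "(1 / 9)\<^sup>2 * indicator {4 / 3..5 / 3} x \<le> bump x" for x
    by (cases "x \<in> {4 / 3..5 / 3}") (auto simp: bump_def)
  have "(\<integral>x. (1 / 9)\<^sup>2 * indicator {4 / 3..5 / 3::real} x \<partial>lborel) \<le> integral\<^sup>L lborel bump"
  proof (rule integral_mono[OF _ _ le])
    show "integrable lborel bump"
      by (rule integrable_compact_support[OF cont_profile supp(1)])
  qed simp
  then have "0 < integral\<^sup>L lborel bump" by (simp add: power2_eq_square)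
  then show ?thesis by simp
qed

context linearised_solution
begin

lemma duhamel:
  assumes "0 \<le> t"
  shows "((\<lambda>s. R s \<xi>) has_integral g t \<xi> - g 0 \<xi>) {0..t}"
proof -
  interpret profile bump "\<lambda>x. 2 * max 0 ((x - 1) * (2 - x)) * (3 - 2 * x)" by (rule profile_bump)
  interpret solution_profile h h0 bump "\<lambda>x. 2 * max 0 ((x - 1) * (2 - x)) * (3 - 2 * x)"
    by unfold_locales
  show ?thesis by (rule duhamel_profile[OF assms integral_bump_nonzero])
qed

lemma duhamel_iterated:
  assumes C: "\<And>s \<eta>. s \<in> {0..T} \<Longrightarrow> \<eta> \<in> {- r..r} \<Longrightarrow> cmod (g s \<eta>) \<le> C"
    and "t \<in> {0..T}" "\<xi> \<in> {- r..r}"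
  shows "cmod (g t \<xi>) \<le> (\<Sum>n<N. (2 * t) ^ n / fact n * cmod (g 0 (\<xi> / 2 ^ n))) + (2 * t) ^ N / fact N * C"
  using assms(2,3)
proof (induction N arbitrary: t \<xi>)
  case 0
  then show ?case using C by simp
next
  case (Suc N)
  let ?c = "\<lambda>n. cmod (g 0 (\<xi> / 2 / 2 ^ n))"
  let ?P = "\<lambda>s. 2 * ((\<Sum>n<N. (2 * s) ^ n / fact n * ?c n) + (2 * s) ^ N / fact N * C)"
  let ?Q = "\<lambda>s. (\<Sum>n<N. (2 * s) ^ Suc n / fact (Suc n) * ?c n) + (2 * s) ^ Suc N / fact (Suc N) * C"
  have mono: "((\<lambda>s. (2 * s) ^ Suc n / fact (Suc n) * c) has_real_derivative 2 * ((2 * s) ^ n / fact n * c)) (at s within A)"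
    for n s A and c :: real
  proof -
    have "((\<lambda>s. (2 * s) ^ Suc n / fact (Suc n) * c) has_real_derivative
        (1 + real n) * (2 * (2 * s) ^ n) / fact (Suc n) * c) (at s within A)"
      by (intro DERIV_cmult_right DERIV_cdivide DERIV_power_Suc DERIV_cmult_Id)
    moreover have "k * (2 * p) / (k * f) * c = 2 * (p / f * c)" if "k \<noteq> 0" for k p f :: real
      using that by simp
    from this[of "1 + real n" "(2 * s) ^ n" "fact n"]
    have "(1 + real n) * (2 * (2 * s) ^ n) / fact (Suc n) * c = 2 * ((2 * s) ^ n / fact n * c)"
      unfolding fact_Suc of_nat_Suc by simp
    ultimately show ?thesis by (simp only:)
  qed
  have Q': "(?Q has_real_derivative ?P s) (at s within A)" for s A
    unfolding distrib_left sum_distrib_left by (intro DERIV_add DERIV_sum mono)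
  have P: "(?P has_integral ?Q t - ?Q 0) {0..t}"
    using Suc.prems(1) Q' by (intro fundamental_theorem_of_calculus)
      (auto simp: has_real_derivative_iff_has_vector_derivative)
  have "cmod (R s \<xi>) \<le> ?P s" if "s \<in> {0..t}" for s
  proof -
    have "cmod (g s (\<xi> / 2)) \<le> (\<Sum>n<N. (2 * s) ^ n / fact n * ?c n) + (2 * s) ^ N / fact N * C"
      using Suc.prems that by (intro Suc.IH) auto
    from order_trans[OF norm_R_le mult_left_mono[OF this]] show ?thesis by simp
  qed
  then have "norm (integral {0..t} (\<lambda>s. R s \<xi>)) \<le> integral {0..t} ?P"
    using duhamel[of t \<xi>] P Suc.prems(1) by (intro integral_norm_bound_integral) auto
  moreover have "integral {0..t} ?P = ?Q t" using integral_unique[OF P] by simp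
  moreover have "integral {0..t} (\<lambda>s. R s \<xi>) = g t \<xi> - g 0 \<xi>"
    using duhamel[of t \<xi>] Suc.prems(1) by (intro integral_unique) auto
  ultimately have "cmod (g t \<xi> - g 0 \<xi>) \<le> ?Q t" by simp
  with norm_triangle_ineq2[of "g t \<xi>" "g 0 \<xi>"]
  have "cmod (g t \<xi>) \<le> cmod (g 0 \<xi>) + ?Q t" by linarith
  then show ?case
    by (simp only: sum.lessThan_Suc_shift) (simp add: add.assoc)
qed

lemma fourier_series_bound:
  assumes t: "0 \<le> t"
  shows "summable (\<lambda>n. (2 * t) ^ n / fact n * cmod (g 0 (\<xi> / 2 ^ n)))"
    and "cmod (g t \<xi>) \<le> (\<Sum>n. (2 * t) ^ n / fact n * cmod (g 0 (\<xi> / 2 ^ n)))"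
proof -
  obtain C where C: "\<And>s \<eta>. s \<in> {0..t} \<Longrightarrow> \<eta> \<in> {- \<bar>\<xi>\<bar>..\<bar>\<xi>\<bar>} \<Longrightarrow> cmod (g s \<eta>) \<le> C"
    using g_locally_bounded[of t "\<bar>\<xi>\<bar>"] by blast
  have e: "summable (\<lambda>n. (2 * t) ^ n / fact n * C)"
    using summable_mult2[OF summable_exp[of "2 * t"], of C] by (simp add: field_simps)
  have in_r: "\<xi> / 2 ^ n \<in> {- \<bar>\<xi>\<bar>..\<bar>\<xi>\<bar>}" for n
  proof -
    have "\<bar>\<xi> / 2 ^ n\<bar> \<le> \<bar>\<xi>\<bar>" by (simp add: abs_divide divide_le_eq mult_le_cancel_left1)
    then show ?thesis unfolding abs_le_iff atLeastAtMost_iff by linarith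
  qed
  show summ: "summable (\<lambda>n. (2 * t) ^ n / fact n * cmod (g 0 (\<xi> / 2 ^ n)))"
  proof (rule summable_comparison_test'[OF e, of 0])
    show "norm ((2 * t) ^ n / fact n * cmod (g 0 (\<xi> / 2 ^ n))) \<le> (2 * t) ^ n / fact n * C" for n
    proof -
      have "cmod (g 0 (\<xi> / 2 ^ n)) \<le> C" using C[OF _ in_r] t by simp
      then have "(2 * t) ^ n / fact n * cmod (g 0 (\<xi> / 2 ^ n)) \<le> (2 * t) ^ n / fact n * C"
        using t by (intro mult_left_mono) auto
      moreover have "0 \<le> (2 * t) ^ n / fact n * cmod (g 0 (\<xi> / 2 ^ n))" using t by auto
      ultimately show ?thesis by (simp only: real_norm_def abs_of_nonneg)
    qed
  qed
  have lim: "(\<lambda>N. (\<Sum>n<N. (2 * t) ^ n / fact n * cmod (g 0 (\<xi> / 2 ^ n))) + (2 * t) ^ N / fact N * C)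
      \<longlonglongrightarrow> (\<Sum>n. (2 * t) ^ n / fact n * cmod (g 0 (\<xi> / 2 ^ n))) + 0"
    by (intro tendsto_add summable_LIMSEQ[OF summ] summable_LIMSEQ_zero[OF e])
  have "cmod (g t \<xi>) \<le> (\<Sum>n<N. (2 * t) ^ n / fact n * cmod (g 0 (\<xi> / 2 ^ n))) + (2 * t) ^ N / fact N * C" for N
    by (rule duhamel_iterated[OF C]) (use t in auto)
  then have "cmod (g t \<xi>) \<le> (\<Sum>n. (2 * t) ^ n / fact n * cmod (g 0 (\<xi> / 2 ^ n))) + 0"
    by (intro LIMSEQ_le_const[OF lim]) blast
  then show "cmod (g t \<xi>) \<le> (\<Sum>n. (2 * t) ^ n / fact n * cmod (g 0 (\<xi> / 2 ^ n)))"
    by (simp only: add_0_right)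
qed

end
subsection \<open>Convexity inequalities\<close>

lemma exp_weighted_le:
  fixes q x :: real
  assumes "0 \<le> q" "q \<le> 1"
  shows "exp (q * x) \<le> q * exp x + (1 - q)"
proof -
  have "exp (q * x) * (q * (1 + (1 - q) * x) + (1 - q) * (1 + - (q * x)))
      \<le> exp (q * x) * (q * exp ((1 - q) * x) + (1 - q) * exp (- (q * x)))"
    using assms by (intro mult_left_mono add_mono exp_ge_add_one_self) auto
  also have "\<dots> = q * exp x + (1 - q)"
    by (simp add: distrib_left exp_add[symmetric] mult.left_commute[of "exp (q * x)"] algebra_simps)
  finally show ?thesis by (simp add: algebra_simps)
qed

lemma two_powr_chord:
  assumes "0 < u" "u < (1 :: real)"
  shows "2 powr - u < 1 - u / 2"
proof -
  have L: "0 < ln (2 :: real)" by simp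
  have "1 + y < exp y" if "0 < y" for y :: real
    using exp_lower_Taylor_quadratic[of y] that by (smt (verit) zero_less_power divide_pos_pos)
  from this[of "u * ln 2"] have 1: "1 + u * ln 2 < exp (u * ln 2)" using assms L by simp
  have 2: "1 + - ((1 - u) * ln 2) \<le> exp (- ((1 - u) * ln 2))" by (rule exp_ge_add_one_self)
  have a: "2 powr - u = exp (- (u * ln 2))" by (simp add: powr_def)
  have lt: "exp (- (u * ln 2)) * ((1 - u) * (1 + u * ln 2) + u * (1 + - ((1 - u) * ln 2)))
      < exp (- (u * ln 2)) * ((1 - u) * exp (u * ln 2) + u * exp (- ((1 - u) * ln 2)))"
    using assms 1 2 by (intro mult_strict_left_mono add_less_le_mono mult_left_mono) auto
  have i1: "exp (- (u * ln 2)) * exp (u * ln 2) = 1"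
    by (simp flip: exp_add)
  have "exp (- (u * ln 2)) * exp (- ((1 - u) * ln 2)) = exp (- ln 2)"
    unfolding exp_add[symmetric] by (rule arg_cong[where f = exp]) (simp add: algebra_simps)
  then have i2: "exp (- (u * ln 2)) * exp (- ((1 - u) * ln 2)) = 1 / 2"
    by (simp add: exp_minus inverse_eq_divide)
  from i1 i2 have "exp (- (u * ln 2)) * ((1 - u) * exp (u * ln 2) + u * exp (- ((1 - u) * ln 2))) = (1 - u) * 1 + u * (1 / 2)"
    by (metis (no_types, lifting) distrib_left mult.left_commute)
  with lt show ?thesis unfolding a by (simp add: algebra_simps)
qed

lemma decay_rate_pos:
  assumes "2 < k" "k < 3"
  shows "0 < decay_rate k"
proof -
  have "2 powr (1 - k) = 2 powr ((2 - k) - 1)" by simp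
  also have "\<dots> = 2 powr (2 - k) / 2" by (subst powr_diff) simp
  finally have "2 powr (1 - k) = 2 powr (2 - k) / 2" .
  moreover have "2 powr (2 - k) < 1 - (k - 2) / 2"
    using two_powr_chord[of "k - 2"] assms by simp
  ultimately show ?thesis unfolding decay_rate_def by (simp add: field_simps)
qed

lemma powr_tangent_le:
  fixes p z :: real
  assumes p: "1 \<le> p" and z: "0 \<le> z"
  shows "1 + p * (z - 1) \<le> z powr p"
proof (cases "z = 0")
  case False
  then have z: "0 < z" using z by simp
  have "exp (1 / p * (p * ln z)) \<le> 1 / p * exp (p * ln z) + (1 - 1 / p)"
    using p by (intro exp_weighted_le) auto
  then have "z \<le> 1 / p * z powr p + (1 - 1 / p)"
    using p z by (simp add: powr_def)
  then have "p * z \<le> p * (1 / p * z powr p + (1 - 1 / p))"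
    using p by (intro mult_left_mono) auto
  also have "\<dots> = z powr p + (p - 1)" using p by (simp add: field_simps)
  finally show ?thesis by (simp add: algebra_simps)
qed (use p in simp)

lemma jensen_powr_series:
  fixes v y :: "nat \<Rightarrow> real"
  assumes p: "1 \<le> p" and v: "\<And>n. 0 \<le> v n" and y: "\<And>n. 0 \<le> y n"
    and W: "v sums W" "0 < W" and S: "summable (\<lambda>n. v n * y n)"
  shows "ennreal ((\<Sum>n. v n * y n) powr p) \<le> ennreal (W powr (p - 1)) * (\<Sum>n. ennreal (v n * y n powr p))"
proof (cases "summable (\<lambda>n. v n * y n powr p)")
  case True
  let ?S = "\<Sum>n. v n * y n"
  have "0 \<le> ?S" using v y by (intro suminf_nonneg S) auto
  show ?thesis
  proof (cases "?S = 0")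
    case False
    define m where "m = ?S / W"
    have m: "0 < m" using False \<open>0 \<le> ?S\<close> W by (simp add: m_def)
    have "(\<lambda>n. m powr p / m * p * (v n * y n) + m powr p * (1 - p) * v n) sums
        (m powr p / m * p * ?S + m powr p * (1 - p) * W)"
      by (intro sums_add sums_mult summable_sums S W)
    also have "m powr p / m * p * ?S + m powr p * (1 - p) * W = W * m powr p"
      using m W by (simp add: m_def field_simps)
    finally have sums: "(\<lambda>n. m powr p / m * p * (v n * y n) + m powr p * (1 - p) * v n) sums (W * m powr p)" .
    have "m powr p / m * p * (v n * y n) + m powr p * (1 - p) * v n \<le> v n * y n powr p" for n
    proof -
      have "m powr p * (1 + p * (y n / m - 1)) \<le> m powr p * (y n / m) powr p"
        using p y m by (intro mult_left_mono powr_tangent_le) auto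
      also have "\<dots> = y n powr p" using m y by (simp add: powr_mult[symmetric])
      finally have "v n * (m powr p * (1 + p * (y n / m - 1))) \<le> v n * y n powr p"
        using v by (intro mult_left_mono)
      moreover have "v n * (m powr p * (1 + p * (y n / m - 1))) = m powr p / m * p * (v n * y n) + m powr p * (1 - p) * v n"
        by (simp add: algebra_simps)
      ultimately show ?thesis by simp
    qed
    from suminf_le[OF this sums_summable[OF sums] True] sums_unique[OF sums]
    have le: "W * m powr p \<le> (\<Sum>n. v n * y n powr p)" by simp
    have "?S = W * m" using W by (simp add: m_def)
    then have "?S powr p = W powr (p - 1) * (W * m powr p)"
      using W m by (simp add: powr_mult powr_diff)
    also have "\<dots> \<le> W powr (p - 1) * (\<Sum>n. v n * y n powr p)"
      using le by (intro mult_left_mono) auto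
    finally have "ennreal (?S powr p) \<le> ennreal (W powr (p - 1) * (\<Sum>n. v n * y n powr p))"
      by (rule ennreal_leI)
    also have "\<dots> = ennreal (W powr (p - 1)) * (\<Sum>n. ennreal (v n * y n powr p))"
      using True v by (subst suminf_ennreal2) (auto simp: ennreal_mult suminf_nonneg)
    finally show ?thesis .
  qed simp
next
  case False
  have "(\<Sum>n. ennreal (v n * y n powr p)) = top"
  proof (rule ccontr)
    assume "\<not> ?thesis"
    then have "summable (\<lambda>n. v n * y n powr p)"
      by (intro summable_suminf_not_top mult_nonneg_nonneg v powr_ge_zero) simp_all
    with False show False by simp
  qed
  then show ?thesis using W by (simp add: ennreal_mult_top)
qed
subsection \<open>Decay of the Fourier norms\<close>

context linearised_solution
begin

lemma g_initial: "g 0 = fourier_transform h0"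
  by (simp add: g_def[abs_def] fourier_transform_initial)

lemma F_eq_g: "F t \<xi> = complex_of_real (exp (- t)) * g t (\<xi> * exp (t / 4))"
proof -
  have "exp (- t) * exp t = 1" "exp (t / 4) * exp (- (t / 4)) = 1" by (simp_all flip: exp_add)
  then have "complex_of_real (exp (- t)) * complex_of_real (exp t) = 1" "\<xi> * exp (t / 4) * exp (- (t / 4)) = \<xi>"
    by (simp_all only: of_real_mult[symmetric] of_real_1 mult.assoc mult_1_right)
  then show ?thesis by (simp only: g_def mult.assoc[symmetric] mult_1_left)
qed

lemma norm_F: "cmod (F t \<xi>) = exp (- t) * cmod (g t (\<xi> * exp (t / 4)))"
  unfolding F_eq_g norm_mult by simp

lemma power_bound:
  assumes t: "0 \<le> t" and M: "\<And>\<xi>. \<xi> \<noteq> 0 \<Longrightarrow> cmod (fourier_transform h0 \<xi>) \<le> M * \<bar>\<xi>\<bar> powr k"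
    and \<xi>: "\<xi> \<noteq> 0"
  shows "cmod (F t \<xi>) \<le> exp (- decay_rate k * t) * M * \<bar>\<xi>\<bar> powr k"
proof -
  let ?\<eta> = "\<xi> * exp (t / 4)"
  have \<eta>: "?\<eta> \<noteq> 0" using \<xi> by simp
  have two: "(2 ^ n) powr k = (2 powr k) ^ n" for n
    by (simp add: powr_power powr_realpow[symmetric] powr_powr mult.commute)
  have term_le: "(2 * t) ^ n / fact n * cmod (g 0 (?\<eta> / 2 ^ n))
      \<le> (2 * t * 2 powr - k) ^ n /\<^sub>R fact n * (M * \<bar>?\<eta>\<bar> powr k)" for n
  proof -
    have "cmod (g 0 (?\<eta> / 2 ^ n)) \<le> M * (\<bar>?\<eta>\<bar> / 2 ^ n) powr k"
      using M[of "?\<eta> / 2 ^ n"] \<eta> unfolding g_initial by simp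
    also have "(\<bar>?\<eta>\<bar> / 2 ^ n) powr k = \<bar>?\<eta>\<bar> powr k * (2 powr - k) ^ n"
      by (subst powr_divide) (simp_all only: two powr_minus power_inverse divide_inverse abs_ge_zero zero_le_power zero_le_numeral)
    finally have "(2 * t) ^ n / fact n * cmod (g 0 (?\<eta> / 2 ^ n))
        \<le> (2 * t) ^ n / fact n * (M * (\<bar>?\<eta>\<bar> powr k * (2 powr - k) ^ n))"
      using t by (intro mult_left_mono) auto
    also have "\<dots> = (2 * t * 2 powr - k) ^ n /\<^sub>R fact n * (M * \<bar>?\<eta>\<bar> powr k)"
      unfolding power_mult_distrib[of "2 * t"] real_scaleR_def divide_inverse by (simp only: mult_ac)
    finally show ?thesis .
  qed
  have sums: "(\<lambda>n. (2 * t * 2 powr - k) ^ n /\<^sub>R fact n * (M * \<bar>?\<eta>\<bar> powr k)) sums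
      (exp (2 * t * 2 powr - k) * (M * \<bar>?\<eta>\<bar> powr k))"
    by (intro sums_mult2 exp_converges)
  have "cmod (g t ?\<eta>) \<le> exp (2 * t * 2 powr - k) * (M * \<bar>?\<eta>\<bar> powr k)"
    using fourier_series_bound[OF t, of ?\<eta>] suminf_le[OF term_le _ sums_summable[OF sums]]
      sums_unique[OF sums] by fastforce
  then have "cmod (F t \<xi>) \<le> exp (- t) * (exp (2 * t * 2 powr - k) * (M * \<bar>?\<eta>\<bar> powr k))"
    unfolding norm_F by (intro mult_left_mono) auto
  also have "\<bar>?\<eta>\<bar> powr k = \<bar>\<xi>\<bar> powr k * exp (k * t / 4)"
    by (simp add: abs_mult powr_mult exp_powr_real mult.commute)
  also have "exp (- t) * (exp (2 * t * 2 powr - k) * (M * (\<bar>\<xi>\<bar> powr k * exp (k * t / 4))))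
      = (exp (- t) * exp (2 * t * 2 powr - k) * exp (k * t / 4)) * M * \<bar>\<xi>\<bar> powr k"
    by (simp add: mult_ac)
  also have "exp (- t) * exp (2 * t * 2 powr - k) * exp (k * t / 4) = exp (- decay_rate k * t)"
  proof -
    have "2 powr (1 - k) = 2 * 2 powr - k" using powr_add[of 2 1 "- k"] by simp
    then show ?thesis
      unfolding exp_add[symmetric] decay_rate_def by (simp add: algebra_simps)
  qed
  finally show ?thesis .
qed

lemma fourier_norm_decay:
  assumes t: "0 \<le> t"
  shows "fourier_norm k (F t) \<le> ennreal (exp (- decay_rate k * t)) * fourier_norm k (fourier_transform h0)"
proof (cases "fourier_norm k (fourier_transform h0) = \<infinity>")
  case True
  then show ?thesis by (simp add: ennreal_mult_top)
next
  case False
  then obtain M where M: "0 \<le> M" "fourier_norm k (fourier_transform h0) = ennreal M"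
    by (cases "fourier_norm k (fourier_transform h0)") auto
  have bound: "cmod (fourier_transform h0 \<xi>) \<le> M * \<bar>\<xi>\<bar> powr k" if "\<xi> \<noteq> 0" for \<xi>
  proof -
    have "ennreal (cmod (fourier_transform h0 \<xi>) / \<bar>\<xi>\<bar> powr k) \<le> ennreal M"
      unfolding M(2)[symmetric] fourier_norm_def using that by (intro SUP_upper) auto
    then have "cmod (fourier_transform h0 \<xi>) / \<bar>\<xi>\<bar> powr k \<le> M" using M(1) by simp
    then show ?thesis using that by (simp add: pos_divide_le_eq)
  qed
  have "ennreal (cmod (F t \<xi>) / \<bar>\<xi>\<bar> powr k) \<le> ennreal (exp (- decay_rate k * t) * M)" if "\<xi> \<in> - {0}" for \<xi>
    using power_bound[OF t bound, of \<xi>] that by (intro ennreal_leI) (simp add: pos_divide_le_eq)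
  then have "fourier_norm k (F t) \<le> ennreal (exp (- decay_rate k * t) * M)"
    unfolding fourier_norm_def by (rule SUP_least)
  then show ?thesis
    unfolding M(2) using M(1) by (simp add: ennreal_mult)
qed

end
lemma nn_integral_rescaled_weight:
  fixes f :: "real \<Rightarrow> real"
  assumes [measurable]: "f \<in> borel_measurable borel" and f: "\<And>x. 0 \<le> f x" and c: "0 < c"
  shows "(\<integral>\<^sup>+x. ennreal (f (c * x) / \<bar>x\<bar> powr a) \<partial>lborel)
    = ennreal (c powr (a - 1)) * (\<integral>\<^sup>+x. ennreal (f x / \<bar>x\<bar> powr a) \<partial>lborel)"
proof -
  have "(\<integral>\<^sup>+x. ennreal (f x / \<bar>x\<bar> powr a) \<partial>lborel)
      = ennreal c * (\<integral>\<^sup>+x. ennreal (f (c * x) / \<bar>c * x\<bar> powr a) \<partial>lborel)"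
    using nn_integral_real_affine[of "\<lambda>x. ennreal (f x / \<bar>x\<bar> powr a)" c 0] c by simp
  also have "(\<integral>\<^sup>+x. ennreal (f (c * x) / \<bar>c * x\<bar> powr a) \<partial>lborel)
      = (\<integral>\<^sup>+x. ennreal (c powr - a) * ennreal (f (c * x) / \<bar>x\<bar> powr a) \<partial>lborel)"
  proof (rule nn_integral_cong)
    fix x
    have "f (c * x) / \<bar>c * x\<bar> powr a = c powr - a * (f (c * x) / \<bar>x\<bar> powr a)"
      using c by (simp add: abs_mult powr_mult powr_minus divide_inverse)
    moreover have "ennreal (c powr - a) * ennreal (f (c * x) / \<bar>x\<bar> powr a) = ennreal (c powr - a * (f (c * x) / \<bar>x\<bar> powr a))"
      using f by (intro ennreal_mult[symmetric]) auto
    ultimately show "ennreal (f (c * x) / \<bar>c * x\<bar> powr a) = ennreal (c powr - a) * ennreal (f (c * x) / \<bar>x\<bar> powr a)"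
      by (simp only:)
  qed
  also have "\<dots> = ennreal (c powr - a) * (\<integral>\<^sup>+x. ennreal (f (c * x) / \<bar>x\<bar> powr a) \<partial>lborel)"
    by (rule nn_integral_cmult) measurable
  finally have "(\<integral>\<^sup>+x. ennreal (f x / \<bar>x\<bar> powr a) \<partial>lborel)
      = ennreal c * (ennreal (c powr - a) * (\<integral>\<^sup>+x. ennreal (f (c * x) / \<bar>x\<bar> powr a) \<partial>lborel))" .
  moreover have "ennreal (c powr (a - 1)) * (ennreal c * (ennreal (c powr - a) * X)) = X" for X
  proof -
    have "c powr (a - 1) * (c * c powr - a) = c powr (a - 1 + (1 + - a))"
      using c by (simp only: powr_add powr_one)
    then have "c powr (a - 1) * (c * c powr - a) = 1" using c by simp
    then have "ennreal (c powr (a - 1)) * (ennreal c * ennreal (c powr - a)) = 1"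
      using c by (simp flip: ennreal_mult)
    then show ?thesis by (simp flip: mult.assoc)
  qed
  ultimately show ?thesis by simp
qed

context linearised_solution
begin

lemma Lp_integral_bound:
  assumes t: "0 \<le> t" and p: "1 \<le> p"
  shows "(\<integral>\<^sup>+\<xi>. ennreal (cmod (F t \<xi>) powr p / \<bar>\<xi>\<bar> powr (k * p)) \<partial>lborel)
    \<le> ennreal (exp (- decay_rate_Lp k p * t) powr p) *
      (\<integral>\<^sup>+\<xi>. ennreal (cmod (fourier_transform h0 \<xi>) powr p / \<bar>\<xi>\<bar> powr (k * p)) \<partial>lborel)"
proof -
  let ?f = "\<lambda>\<xi>. cmod (g 0 \<xi>)"
  define I where "I = (\<integral>\<^sup>+\<xi>. ennreal (?f \<xi> powr p / \<bar>\<xi>\<bar> powr (k * p)) \<partial>lborel)"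
  define r where "r = 2 powr (1 / p - k)"
  define v where "v n = (2 * t * r) ^ n /\<^sub>R fact n" for n :: nat
  define W where "W = exp (2 * t * r)"
  have r: "0 < r" by (simp add: r_def)
  have v0: "0 \<le> v n" for n using t r by (simp add: v_def)
  have W: "v sums W" "0 < W" unfolding v_def W_def by (rule exp_converges) simp
  have meas: "(\<lambda>\<xi>. cmod (g s \<xi>) powr p) \<in> borel_measurable borel" if "0 \<le> s" for s
  proof -
    have [measurable]: "g s \<in> borel_measurable borel"
      by (rule borel_measurable_continuous_onI[OF continuous_on_g[OF that]])
    show ?thesis by measurable
  qed
  have [measurable]: "g 0 \<in> borel_measurable borel"
    by (rule borel_measurable_continuous_onI[OF continuous_on_g]) simp
  have rpow: "(r ^ n) powr p = (2 ^ n) powr (1 - k * p)" for n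
  proof -
    have "(r ^ n) powr p = 2 powr ((1 / p - k) * n * p)"
      unfolding r_def by (simp add: powr_power powr_powr mult_ac)
    also have "(1 / p - k) * n * p = n * (1 - k * p)" using p by (simp add: field_simps)
    also have "2 powr (n * (1 - k * p)) = (2 ^ n) powr (1 - k * p)"
      by (simp add: powr_realpow[symmetric] powr_powr)
    finally show ?thesis .
  qed
  have pointwise: "ennreal (cmod (g t \<eta>) powr p / \<bar>\<eta>\<bar> powr (k * p))
      \<le> ennreal (W powr (p - 1)) * (\<Sum>n. ennreal (v n / (r ^ n) powr p) * ennreal (?f (\<eta> / 2 ^ n) powr p / \<bar>\<eta>\<bar> powr (k * p)))" for \<eta>
  proof -
    have vy: "v n * (?f (\<eta> / 2 ^ n) / r ^ n) = (2 * t) ^ n / fact n * ?f (\<eta> / 2 ^ n)" for n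
      using r by (simp add: v_def power_mult_distrib[of "2 * t"] divide_inverse del: power_mult_distrib)
    note fb = fourier_series_bound[OF t, of \<eta>]
    have "cmod (g t \<eta>) powr p \<le> (\<Sum>n. v n * (?f (\<eta> / 2 ^ n) / r ^ n)) powr p"
      unfolding vy using p by (intro powr_mono2 fb(2)) auto
    then have "ennreal (cmod (g t \<eta>) powr p) \<le> ennreal ((\<Sum>n. v n * (?f (\<eta> / 2 ^ n) / r ^ n)) powr p)"
      by (rule ennreal_leI)
    also have "\<dots> \<le> ennreal (W powr (p - 1)) * (\<Sum>n. ennreal (v n * (?f (\<eta> / 2 ^ n) / r ^ n) powr p))"
    proof (rule jensen_powr_series[OF p v0 _ W])
      show "summable (\<lambda>n. v n * (?f (\<eta> / 2 ^ n) / r ^ n))" unfolding vy by (rule fb(1))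
    qed (use r in auto)
    finally have le: "ennreal (cmod (g t \<eta>) powr p) \<le> ennreal (W powr (p - 1)) * (\<Sum>n. ennreal (v n * (?f (\<eta> / 2 ^ n) / r ^ n) powr p))" .
    let ?d = "inverse (\<bar>\<eta>\<bar> powr (k * p))"
    have "ennreal (cmod (g t \<eta>) powr p / \<bar>\<eta>\<bar> powr (k * p)) = ennreal (cmod (g t \<eta>) powr p) * ennreal ?d"
      by (simp add: divide_inverse ennreal_mult)
    also have "\<dots> \<le> ennreal (W powr (p - 1)) * (\<Sum>n. ennreal (v n * (?f (\<eta> / 2 ^ n) / r ^ n) powr p)) * ennreal ?d"
      by (rule mult_right_mono[OF le]) simp
    also have "\<dots> = ennreal (W powr (p - 1)) * (\<Sum>n. ennreal (v n * (?f (\<eta> / 2 ^ n) / r ^ n) powr p) * ennreal ?d)"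
      by (simp only: mult.assoc ennreal_suminf_multc)
    also have "(\<lambda>n. ennreal (v n * (?f (\<eta> / 2 ^ n) / r ^ n) powr p) * ennreal ?d)
        = (\<lambda>n. ennreal (v n / (r ^ n) powr p) * ennreal (?f (\<eta> / 2 ^ n) powr p / \<bar>\<eta>\<bar> powr (k * p)))"
    proof
      fix n
      have "v n * (?f (\<eta> / 2 ^ n) / r ^ n) powr p * ?d = v n / (r ^ n) powr p * (?f (\<eta> / 2 ^ n) powr p / \<bar>\<eta>\<bar> powr (k * p))"
        using r by (subst powr_divide) (auto simp: divide_inverse)
      then show "ennreal (v n * (?f (\<eta> / 2 ^ n) / r ^ n) powr p) * ennreal ?d
          = ennreal (v n / (r ^ n) powr p) * ennreal (?f (\<eta> / 2 ^ n) powr p / \<bar>\<eta>\<bar> powr (k * p))"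
        using v0[of n] by (simp flip: ennreal_mult)
    qed
    finally show ?thesis .
  qed
  have scale: "(\<integral>\<^sup>+\<eta>. ennreal (?f (\<eta> / 2 ^ n) powr p / \<bar>\<eta>\<bar> powr (k * p)) \<partial>lborel) = ennreal ((r ^ n) powr p) * I" for n
  proof -
    have "(inverse (2 ^ n)) powr (k * p - 1) = (2 ^ n :: real) powr (1 - k * p)"
      by (simp add: inverse_powr powr_minus[symmetric])
    then show ?thesis
      using nn_integral_rescaled_weight[OF meas[of 0], of "inverse (2 ^ n)" "k * p"]
      by (simp add: I_def rpow divide_inverse mult.commute)
  qed
  have "(\<integral>\<^sup>+\<eta>. ennreal (cmod (g t \<eta>) powr p / \<bar>\<eta>\<bar> powr (k * p)) \<partial>lborel)
      \<le> (\<integral>\<^sup>+\<eta>. ennreal (W powr (p - 1)) * (\<Sum>n. ennreal (v n / (r ^ n) powr p) * ennreal (?f (\<eta> / 2 ^ n) powr p / \<bar>\<eta>\<bar> powr (k * p))) \<partial>lborel)"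
    by (intro nn_integral_mono pointwise)
  also have "\<dots> = ennreal (W powr (p - 1)) * (\<Sum>n. ennreal (v n / (r ^ n) powr p) * (\<integral>\<^sup>+\<eta>. ennreal (?f (\<eta> / 2 ^ n) powr p / \<bar>\<eta>\<bar> powr (k * p)) \<partial>lborel))"
    by (simp add: nn_integral_cmult nn_integral_suminf)
  also have "\<dots> = ennreal (W powr (p - 1)) * (\<Sum>n. ennreal (v n) * I)"
  proof -
    have "ennreal (v n / (r ^ n) powr p) * (ennreal ((r ^ n) powr p) * I) = ennreal (v n) * I" for n
      using r v0[of n] by (simp flip: mult.assoc ennreal_mult)
    then show ?thesis by (simp only: scale)
  qed
  also have "(\<Sum>n. ennreal (v n) * I) = ennreal W * I"
    using suminf_ennreal_eq[OF v0 W(1)] by (simp only: ennreal_suminf_multc)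
  also have "ennreal (W powr (p - 1)) * (ennreal W * I) = ennreal (W powr p) * I"
    using W(2) by (simp add: powr_diff flip: mult.assoc ennreal_mult)
  finally have gle: "(\<integral>\<^sup>+\<eta>. ennreal (cmod (g t \<eta>) powr p / \<bar>\<eta>\<bar> powr (k * p)) \<partial>lborel) \<le> ennreal (W powr p) * I" .
  have "(\<integral>\<^sup>+\<xi>. ennreal (cmod (F t \<xi>) powr p / \<bar>\<xi>\<bar> powr (k * p)) \<partial>lborel)
      = (\<integral>\<^sup>+\<xi>. ennreal (exp (- t) powr p) * ennreal (cmod (g t (exp (t / 4) * \<xi>)) powr p / \<bar>\<xi>\<bar> powr (k * p)) \<partial>lborel)"
    by (intro nn_integral_cong) (simp add: norm_F powr_mult mult.commute[of "exp (t / 4)"] flip: ennreal_mult)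
  also have "\<dots> = ennreal (exp (- t) powr p) * (\<integral>\<^sup>+\<xi>. ennreal (cmod (g t (exp (t / 4) * \<xi>)) powr p / \<bar>\<xi>\<bar> powr (k * p)) \<partial>lborel)"
  proof (rule nn_integral_cmult)
    have [measurable]: "g t \<in> borel_measurable borel"
      by (rule borel_measurable_continuous_onI[OF continuous_on_g[OF t]])
    show "(\<lambda>\<xi>. ennreal (cmod (g t (exp (t / 4) * \<xi>)) powr p / \<bar>\<xi>\<bar> powr (k * p))) \<in> borel_measurable lborel"
      by measurable
  qed
  also have "(\<integral>\<^sup>+\<xi>. ennreal (cmod (g t (exp (t / 4) * \<xi>)) powr p / \<bar>\<xi>\<bar> powr (k * p)) \<partial>lborel)
      = ennreal (exp (t / 4) powr (k * p - 1)) * (\<integral>\<^sup>+\<eta>. ennreal (cmod (g t \<eta>) powr p / \<bar>\<eta>\<bar> powr (k * p)) \<partial>lborel)"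
    by (rule nn_integral_rescaled_weight[OF meas[OF t]]) auto
  also have "ennreal (exp (- t) powr p) * (ennreal (exp (t / 4) powr (k * p - 1)) * (\<integral>\<^sup>+\<eta>. ennreal (cmod (g t \<eta>) powr p / \<bar>\<eta>\<bar> powr (k * p)) \<partial>lborel))
      \<le> ennreal (exp (- t) powr p) * (ennreal (exp (t / 4) powr (k * p - 1)) * (ennreal (W powr p) * I))"
    by (intro mult_left_mono gle) auto
  also have "\<dots> = ennreal (exp (- decay_rate_Lp k p * t) powr p) * I"
  proof -
    have "2 powr (1 + 1 / p - k) = 2 * r"
      using powr_add[of 2 1 "1 / p - k"] by (simp add: r_def add_diff_eq)
    then have "(- t) * p + (t / 4 * (k * p - 1) + 2 * t * r * p) = (- decay_rate_Lp k p * t) * p"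
      unfolding decay_rate_Lp_def using p by (simp add: field_simps)
    then have "exp (- t) powr p * (exp (t / 4) powr (k * p - 1) * W powr p) = exp (- decay_rate_Lp k p * t) powr p"
      unfolding W_def exp_powr_real by (simp only: exp_add[symmetric])
    then show ?thesis by (simp flip: mult.assoc ennreal_mult)
  qed
  finally show ?thesis by (simp only: I_def g_initial)
qed

end

lemma ennreal_powr_mult_le:
  assumes "x \<le> ennreal c * y" "0 < c" "0 < a"
  shows "ennreal_powr x a \<le> ennreal (c powr a) * ennreal_powr y a"
proof (cases "y = \<infinity>")
  case True
  then show ?thesis using assms by (simp add: ennreal_powr_def ennreal_mult_top)
next
  case False
  then obtain z where z: "0 \<le> z" "y = ennreal z" by (cases y) auto
  have xle: "x \<le> ennreal (c * z)" using assms z by (simp add: ennreal_mult)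
  then obtain w where w: "0 \<le> w" "x = ennreal w" by (cases x) (auto simp: top_unique)
  have "w \<le> c * z" using xle w z assms by simp
  then have "w powr a \<le> (c * z) powr a" using w assms by (intro powr_mono2) auto
  then have "ennreal (w powr a) \<le> ennreal (c powr a * z powr a)"
    using assms z by (intro ennreal_leI) (simp add: powr_mult)
  then show ?thesis using w z by (simp add: ennreal_powr_def ennreal_mult)
qed

lemma (in linearised_solution) fourier_norm_Lp_decay:
  assumes "0 \<le> t" "1 \<le> p"
  shows "fourier_norm_Lp k p (F t)
    \<le> ennreal (exp (- decay_rate_Lp k p * t)) * fourier_norm_Lp k p (fourier_transform h0)"
proof -
  have "(exp (- decay_rate_Lp k p * t) powr p) powr (1 / p) = exp (- decay_rate_Lp k p * t)"
    using assms by (simp add: powr_powr)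
  then show ?thesis
    using ennreal_powr_mult_le[OF Lp_integral_bound[OF assms, of k], of "1 / p"] assms
    unfolding fourier_norm_Lp_def by simp
qed

theorem theorem1p6:
  fixes h :: "real \<Rightarrow> real set \<Rightarrow> real" and h0 :: "real set \<Rightarrow> real"
  assumes "weak_solution h h0"
    and "signed_integral borel h0 (\<lambda>x. 1 :: real) = 0"
    and "signed_integral borel h0 (\<lambda>x. x) = 0"
    and "signed_integral borel h0 (\<lambda>x. x\<^sup>2) = 0"
  shows "(\<forall>k. 0 \<le> k \<and> k < 3 \<longrightarrow>
            (\<forall>t\<ge>0. fourier_norm k (fourier_transform (h t))
                     \<le> ennreal (exp (- decay_rate k * t)) * fourier_norm k (fourier_transform h0)))
       \<and> (\<forall>k. 2 < k \<and> k < 3 \<longrightarrow>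
            decay_rate k > 0 \<and>
            (fourier_norm k (fourier_transform h0) < \<infinity> \<longrightarrow>
              (\<exists>C c. 0 < c \<and>
                (\<forall>t\<ge>0. fourier_norm k (fourier_transform (h t)) \<le> ennreal (C * exp (- c * t))))))
       \<and> (\<forall>k p. 0 \<le> k \<and> k < 3 \<and> 1 \<le> p \<longrightarrow>
            (\<forall>t\<ge>0. fourier_norm_Lp k p (fourier_transform (h t))
                     \<le> ennreal (exp (- decay_rate_Lp k p * t))
                        * fourier_norm_Lp k p (fourier_transform h0)))"

proof -
  interpret linearised_solution h h0
    using assms(1,2) by unfold_locales
  show ?thesis
  proof (intro conjI allI impI)
    fix k t :: real assume "0 \<le> k \<and> k < 3" "0 \<le> t"
    then show "fourier_norm k (F t) \<le> ennreal (exp (- decay_rate k * t)) * fourier_norm k (fourier_transform h0)"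
      by (intro fourier_norm_decay) simp
  next
    fix k :: real assume "2 < k \<and> k < 3"
    then show pos: "0 < decay_rate k" by (intro decay_rate_pos) auto
    assume "fourier_norm k (fourier_transform h0) < \<infinity>"
    then obtain M where M: "0 \<le> M" "fourier_norm k (fourier_transform h0) = ennreal M"
      by (cases "fourier_norm k (fourier_transform h0)") auto
    have "fourier_norm k (F t) \<le> ennreal (M * exp (- decay_rate k * t))" if "0 \<le> t" for t
      using fourier_norm_decay[OF that, of k] M by (simp add: ennreal_mult mult.commute)
    with pos show "\<exists>C c. 0 < c \<and> (\<forall>t\<ge>0. fourier_norm k (F t) \<le> ennreal (C * exp (- c * t)))"
      by blast
  next
    fix k p t :: real assume "0 \<le> k \<and> k < 3 \<and> 1 \<le> p" "0 \<le> t"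
    then show "fourier_norm_Lp k p (F t)
        \<le> ennreal (exp (- decay_rate_Lp k p * t)) * fourier_norm_Lp k p (fourier_transform h0)"
      by (intro fourier_norm_Lp_decay) auto
  qed
qed

end
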